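(* The crossed interval subgroups (crossed $\nabla$-subgroups) of the Weyl crossed interval group $\mathfrak W_\nabla$ are exactly the following six, where the group at the object of index $n$ ($n\in\mathbb N$) is listed as a subgroup of $\mathfrak W_\nabla(n)$: 1. Trivial $\ast$: the trivial group. 2. Reflexive $C_2$: $\{e,(\rho_n;-1,\dots,-1;-1)\}\cong C_2$, where $\rho_n(i)=n+1-i$. 3. Symmetric $\mathfrak S$: $\{(\sigma;1,\dots,1;1)\mid\sigma\in\mathfrak S_n\}\cong\mathfrak S_n$. 4. Reflexosymmetric $\widetilde{\mathfrak S}$: $\{(\sigma;\delta,\dots,\delta;\delta)\mid\sigma\in\mathfrak S_n,\ \delta\in C_2\}\cong\mathfrak S_n\times C_2$. 5. Hyperoctahedral $\mathfrak H$: $\{(\sigma;\vec\varepsilon;1)\mid\sigma\in\mathfrak S_n,\ \vec\varepsilon\in C_2^{\times n}\}\cong H_n$. 6. Weyl $\mathfrak W_\nabla$ itself: $\mathfrak W_\nabla(n)\cong H_n\times C_2$.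
   Context: For a small category $\mathcal A$, an $\mathcal A$-set is a presheaf of sets on $\mathcal A$. A crossed $\mathcal A$-group is an $\mathcal A$-set $G$ together with a group structure on each $G(a)$ and a left action $G(b)\times\mathcal A(a,b)\to\mathcal A(a,b)$, $(x,\varphi)\mapsto\varphi^x$, of the group $G(b)$ for all $a,b$, such that $(\psi\varphi)^x=\psi^x\varphi^{\psi^\ast(x)}$ for $\varphi:a\to b$, $\psi:b\to c$, $x\in G(c)$, and $\varphi^\ast(xy)=(\varphi^y)^\ast(x)\varphi^\ast(y)$ for $\varphi:a\to b$, $x,y\in G(b)$. A crossed $\mathcal A$-subgroup is a sub-$\mathcal A$-set which is degreewise a subgroup, with the restricted actions. $\nabla$ is the category whose objects are the totally ordered sets $\{-\infty,1,\dots,n,\infty\}$ for $n\in\mathbb N$ (the object of index $n$) and whose morphisms are the order-preserving maps fixing $-\infty$ and $\infty$. Crossed $\nabla$-groups are called crossed interval groups. Let $C_2=\{1,-1\}$, let $\mathfrak S_n$ be the symmetric group on $\{1,\dots,n\}$, and let $H_n=\mathfrak S_n\ltimes C_2^{\times n}$ be the hyperoctahedral group, with multiplication $(\sigma;\varepsilon_1,\dots,\varepsilon_n)(\tau;\zeta_1,\dots,\zeta_n)=(\sigma\tau;\varepsilon_{\tau(1)}\zeta_1,\dots,\varepsilon_{\tau(n)}\zeta_n)$. The Weyl crossed interval group $\mathfrak W_\nabla$ (a terminal crossed interval group) is as follows. $\mathfrak W_\nabla(n)=H_n\times C_2$, with elements written $x=(\sigma;\varepsilon_1,\dots,\varepsilon_n;\theta)$;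 put $\varepsilon_{-\infty}=\varepsilon_\infty=\theta$. Such $x$ permutes $\{-\infty,1,\dots,n,\infty\}$ by acting as $\sigma$ on $\{1,\dots,n\}$ and by exchanging $-\infty,\infty$ if $\theta=-1$ (fixing them if $\theta=1$); denote this permutation by $\pi_x$. For $\varphi$ in $\nabla$ from the object of index $m$ to that of index $n$, $\varphi^x$ is the unique order-preserving map with $\pi_x\varphi=\varphi^x\tau$ for some permutation $\tau$ of $\{-\infty,1,\dots,m,\infty\}$ (it is a morphism of $\nabla$). The element $\varphi^\ast(x)\in\mathfrak W_\nabla(m)$ is the one whose permutation $\tau=\pi_{\varphi^\ast(x)}$ is the unique permutation such that $\pi_x\varphi=\varphi^x\tau$ and, for each $i\in\{-\infty,1,\dots,n,\infty\}$, $\tau$ restricts to a bijection $\varphi^{-1}\{i\}\to(\varphi^x)^{-1}\{\pi_x(i)\}$ that is order-preserving if $\varepsilon_i=1$ and order-reversing if $\varepsilon_i=-1$; its signs are $\varepsilon'_j=\varepsilon_{\varphi(j)}$ for $1\le j\le m$, and its last component is $\theta$. *)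

theory Defs
  imports "HOL-Algebra.Sym_Groups" "HOL-Library.Extended" "HOL-Library.FuncSet"
begin

section \<open>Crossed groups over a small category\<close>

text \<open>
  Source and target are passed explicitly to composition, pullback and action, so that a morphism
  may be represented by a value that does not determine them. \<open>Comp A a b c \<psi> \<phi>\<close> is \<open>\<psi>\<phi>\<close>
  for \<open>\<phi> : a \<rightarrow> b\<close> and \<open>\<psi> : b \<rightarrow> c\<close>.
\<close>

record ('o, 'm) category =
  Obj :: "'o set"
  Hom :: "'o \<Rightarrow> 'o \<Rightarrow> 'm set"
  Ident :: "'o \<Rightarrow> 'm"
  Comp :: "'o \<Rightarrow> 'o \<Rightarrow> 'o \<Rightarrow> 'm \<Rightarrow> 'm \<Rightarrow> 'm"

locale small_category =
  fixes A :: "('o, 'm) category"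
  assumes ident_closed: "a \<in> Obj A \<Longrightarrow> Ident A a \<in> Hom A a a"
    and comp_closed: "\<lbrakk>a \<in> Obj A; b \<in> Obj A; c \<in> Obj A; \<phi> \<in> Hom A a b; \<psi> \<in> Hom A b c\<rbrakk>
      \<Longrightarrow> Comp A a b c \<psi> \<phi> \<in> Hom A a c"
    and comp_ident: "\<lbrakk>a \<in> Obj A; b \<in> Obj A; \<phi> \<in> Hom A a b\<rbrakk>
      \<Longrightarrow> Comp A a a b \<phi> (Ident A a) = \<phi>"
    and ident_comp: "\<lbrakk>a \<in> Obj A; b \<in> Obj A; \<phi> \<in> Hom A a b\<rbrakk>
      \<Longrightarrow> Comp A a b b (Ident A b) \<phi> = \<phi>"
    and comp_assoc: "\<lbrakk>a \<in> Obj A; b \<in> Obj A; c \<in> Obj A; d \<in> Obj A;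
        \<phi> \<in> Hom A a b; \<psi> \<in> Hom A b c; \<chi> \<in> Hom A c d\<rbrakk>
      \<Longrightarrow> Comp A a c d \<chi> (Comp A a b c \<psi> \<phi>) = Comp A a b d (Comp A b c d \<chi> \<psi>) \<phi>"

text \<open>
  For \<open>\<phi> : a \<rightarrow> b\<close> and \<open>x \<in> G(b)\<close>, \<open>Pull G a b \<phi> x\<close> is \<open>\<phi>\<^sup>*(x)\<close> and \<open>Act G a b x \<phi>\<close> is \<open>\<phi>\<^sup>x\<close>.
  Pullbacks are not required to be homomorphisms.
\<close>

record ('o, 'm, 'g) crossed_data =
  Grp :: "'o \<Rightarrow> 'g monoid"
  Pull :: "'o \<Rightarrow> 'o \<Rightarrow> 'm \<Rightarrow> 'g \<Rightarrow> 'g"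
  Act :: "'o \<Rightarrow> 'o \<Rightarrow> 'g \<Rightarrow> 'm \<Rightarrow> 'm"

locale crossed_group = small_category A
  for A :: "('o, 'm) category" +
  fixes G :: "('o, 'm, 'g) crossed_data"
  assumes group: "a \<in> Obj A \<Longrightarrow> group (Grp G a)"
    and pull_closed: "\<lbrakk>a \<in> Obj A; b \<in> Obj A; \<phi> \<in> Hom A a b; x \<in> carrier (Grp G b)\<rbrakk>
      \<Longrightarrow> Pull G a b \<phi> x \<in> carrier (Grp G a)"
    and pull_ident: "\<lbrakk>a \<in> Obj A; x \<in> carrier (Grp G a)\<rbrakk> \<Longrightarrow> Pull G a a (Ident A a) x = x"
    and pull_comp: "\<lbrakk>a \<in> Obj A; b \<in> Obj A; c \<in> Obj A; \<phi> \<in> Hom A a b; \<psi> \<in> Hom A b c;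
        x \<in> carrier (Grp G c)\<rbrakk>
      \<Longrightarrow> Pull G a c (Comp A a b c \<psi> \<phi>) x = Pull G a b \<phi> (Pull G b c \<psi> x)"
    and act_closed: "\<lbrakk>a \<in> Obj A; b \<in> Obj A; \<phi> \<in> Hom A a b; x \<in> carrier (Grp G b)\<rbrakk>
      \<Longrightarrow> Act G a b x \<phi> \<in> Hom A a b"
    and act_one: "\<lbrakk>a \<in> Obj A; b \<in> Obj A; \<phi> \<in> Hom A a b\<rbrakk>
      \<Longrightarrow> Act G a b \<one>\<^bsub>Grp G b\<^esub> \<phi> = \<phi>"
    and act_mult: "\<lbrakk>a \<in> Obj A; b \<in> Obj A; \<phi> \<in> Hom A a b;
        x \<in> carrier (Grp G b); y \<in> carrier (Grp G b)\<rbrakk>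
      \<Longrightarrow> Act G a b (x \<otimes>\<^bsub>Grp G b\<^esub> y) \<phi> = Act G a b x (Act G a b y \<phi>)"
    and act_comp: "\<lbrakk>a \<in> Obj A; b \<in> Obj A; c \<in> Obj A; \<phi> \<in> Hom A a b; \<psi> \<in> Hom A b c;
        x \<in> carrier (Grp G c)\<rbrakk>
      \<Longrightarrow> Act G a c x (Comp A a b c \<psi> \<phi>)
        = Comp A a b c (Act G b c x \<psi>) (Act G a b (Pull G b c \<psi> x) \<phi>)"
    and pull_mult: "\<lbrakk>a \<in> Obj A; b \<in> Obj A; \<phi> \<in> Hom A a b;
        x \<in> carrier (Grp G b); y \<in> carrier (Grp G b)\<rbrakk>
      \<Longrightarrow> Pull G a b \<phi> (x \<otimes>\<^bsub>Grp G b\<^esub> y)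
        = Pull G a b (Act G a b y \<phi>) x \<otimes>\<^bsub>Grp G a\<^esub> Pull G a b \<phi> y"

locale crossed_subgroup = crossed_group A G
  for A :: "('o, 'm) category" and G :: "('o, 'm, 'g) crossed_data" +
  fixes K :: "'o \<Rightarrow> 'g set"
  assumes subgroup: "a \<in> Obj A \<Longrightarrow> subgroup (K a) (Grp G a)"
    and sub_pull_closed: "\<lbrakk>a \<in> Obj A; b \<in> Obj A; \<phi> \<in> Hom A a b; x \<in> K b\<rbrakk>
      \<Longrightarrow> Pull G a b \<phi> x \<in> K a"

section \<open>The category of intervals\<close>

text \<open>
  \<open>Minf\<close> and \<open>Pinf\<close> are \<open>-\<infinity>\<close> and \<open>\<infinity>\<close>. Morphisms are extensional functions
  (\<open>undefined\<close> outside their source), so that equality of morphisms is equality in HOL.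
\<close>

definition interval :: "nat \<Rightarrow> nat extended set" where
  "interval n = {Minf, Pinf} \<union> Fin ` {1..n}"

definition nabla :: "(nat, nat extended \<Rightarrow> nat extended) category" where
  "nabla = \<lparr>
     Obj = UNIV,
     Hom = (\<lambda>m n. {\<phi> \<in> interval m \<rightarrow>\<^sub>E interval n.
                     mono_on (interval m) \<phi> \<and> \<phi> Minf = Minf \<and> \<phi> Pinf = Pinf}),
     Ident = (\<lambda>n. restrict id (interval n)),
     Comp = (\<lambda>l m n \<psi> \<phi>. compose (interval l) \<psi> \<phi>)\<rparr>"

section \<open>The Weyl crossed interval group\<close>

text \<open>
  \<open>C\<^sub>2\<close> is the library's \<open>sign_img\<close>, the group \<open>{1, -1}\<close> of integers, and \<open>\<SS>\<^sub>n\<close> its \<open>sym_group n\<close>.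
  Sign vectors are extensional on \<open>{1..n}\<close>.
\<close>

definition hyperoctahedral_group :: "nat \<Rightarrow> ((nat \<Rightarrow> nat) \<times> (nat \<Rightarrow> int)) monoid" where
  "hyperoctahedral_group n = \<lparr>
     carrier = carrier (sym_group n) \<times> ({1..n} \<rightarrow>\<^sub>E carrier sign_img),
     mult = (\<lambda>(\<sigma>, \<epsilon>) (\<tau>, \<zeta>). (\<sigma> \<circ> \<tau>, \<lambda>i\<in>{1..n}. \<epsilon> (\<tau> i) * \<zeta> i)),
     one = (id, \<lambda>i\<in>{1..n}. 1)\<rparr>"

text \<open>The element \<open>(\<sigma>; \<epsilon>\<^sub>1, \<dots>, \<epsilon>\<^sub>n; \<theta>)\<close> is written \<open>((\<sigma>, \<epsilon>), \<theta>)\<close>.\<close>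

type_synonym weyl_elt = "((nat \<Rightarrow> nat) \<times> (nat \<Rightarrow> int)) \<times> int"

definition weyl_group :: "nat \<Rightarrow> weyl_elt monoid" where
  "weyl_group n = hyperoctahedral_group n \<times>\<times> sign_img"

fun weyl_perm :: "weyl_elt \<Rightarrow> nat extended \<Rightarrow> nat extended" where
  "weyl_perm ((\<sigma>, \<epsilon>), \<theta>) (Fin i) = Fin (\<sigma> i)"
| "weyl_perm ((\<sigma>, \<epsilon>), \<theta>) Minf = (if \<theta> = -1 then Pinf else Minf)"
| "weyl_perm ((\<sigma>, \<epsilon>), \<theta>) Pinf = (if \<theta> = -1 then Minf else Pinf)"

fun weyl_sign :: "weyl_elt \<Rightarrow> nat extended \<Rightarrow> int" where
  "weyl_sign ((\<sigma>, \<epsilon>), \<theta>) (Fin i) = \<epsilon> i"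
| "weyl_sign ((\<sigma>, \<epsilon>), \<theta>) Minf = \<theta>"
| "weyl_sign ((\<sigma>, \<epsilon>), \<theta>) Pinf = \<theta>"

definition weyl_act ::
    "nat \<Rightarrow> nat \<Rightarrow> weyl_elt \<Rightarrow> (nat extended \<Rightarrow> nat extended) \<Rightarrow> (nat extended \<Rightarrow> nat extended)"
  where
  "weyl_act m n x \<phi> = (THE \<phi>'. \<phi>' \<in> interval m \<rightarrow>\<^sub>E interval n \<and> mono_on (interval m) \<phi>' \<and>
     (\<exists>\<tau>. \<tau> permutes interval m \<and> (\<forall>j\<in>interval m. weyl_perm x (\<phi> j) = \<phi>' (\<tau> j))))"

definition weyl_pull ::
    "nat \<Rightarrow> nat \<Rightarrow> (nat extended \<Rightarrow> nat extended) \<Rightarrow> weyl_elt \<Rightarrow> weyl_elt" where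
  "weyl_pull m n \<phi> x = (THE y. y \<in> carrier (weyl_group m) \<and>
     (\<forall>j\<in>interval m. weyl_perm x (\<phi> j) = weyl_act m n x \<phi> (weyl_perm y j)) \<and>
     (\<forall>i\<in>interval n.
        bij_betw (weyl_perm y) {j \<in> interval m. \<phi> j = i}
          {j \<in> interval m. weyl_act m n x \<phi> j = weyl_perm x i} \<and>
        (weyl_sign x i = 1 \<longrightarrow> mono_on {j \<in> interval m. \<phi> j = i} (weyl_perm y)) \<and>
        (weyl_sign x i = -1 \<longrightarrow> antimono_on {j \<in> interval m. \<phi> j = i} (weyl_perm y))) \<and>
     (\<forall>j\<in>{1..m}. weyl_sign y (Fin j) = weyl_sign x (\<phi> (Fin j))) \<and>
     snd y = snd x)"

definition weyl :: "(nat, nat extended \<Rightarrow> nat extended, weyl_elt) crossed_data" where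
  "weyl = \<lparr>Grp = weyl_group, Pull = weyl_pull, Act = weyl_act\<rparr>"

section \<open>The six families of subgroups\<close>

definition trivial_family :: "nat \<Rightarrow> weyl_elt set" where
  "trivial_family n = {\<one>\<^bsub>weyl_group n\<^esub>}"

definition reversal :: "nat \<Rightarrow> nat \<Rightarrow> nat" where
  "reversal n i = (if i \<in> {1..n} then n + 1 - i else i)"

definition reflexive_family :: "nat \<Rightarrow> weyl_elt set" where
  "reflexive_family n = {\<one>\<^bsub>weyl_group n\<^esub>, ((reversal n, \<lambda>i\<in>{1..n}. -1), -1)}"

definition symmetric_family :: "nat \<Rightarrow> weyl_elt set" where
  "symmetric_family n = {((\<sigma>, \<lambda>i\<in>{1..n}. 1), 1) | \<sigma>. \<sigma> \<in> carrier (sym_group n)}"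

definition reflexosymmetric_family :: "nat \<Rightarrow> weyl_elt set" where
  "reflexosymmetric_family n =
     {((\<sigma>, \<lambda>i\<in>{1..n}. \<delta>), \<delta>) | \<sigma> \<delta>. \<sigma> \<in> carrier (sym_group n) \<and> \<delta> \<in> carrier sign_img}"

definition hyperoctahedral_family :: "nat \<Rightarrow> weyl_elt set" where
  "hyperoctahedral_family n =
     {((\<sigma>, \<epsilon>), 1) | \<sigma> \<epsilon>. \<sigma> \<in> carrier (sym_group n) \<and> \<epsilon> \<in> {1..n} \<rightarrow>\<^sub>E carrier sign_img}"

definition weyl_family :: "nat \<Rightarrow> weyl_elt set" where
  "weyl_family n = carrier (weyl_group n)"

end

theory Submission
  imports Defs "HOL-Library.Product_Lexorder"
begin

text \<open>
  Given \<open>\<phi>\<close> and \<open>x\<close>, sorting the source of \<open>\<phi>\<close> lexicographically by \<open>\<pi>\<^sub>x\<phi>\<close> and then by position,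
  reversed on the fibres of sign \<open>-1\<close>, produces \<open>\<phi>\<^sup>*(x)\<close> and \<open>\<phi>\<^sup>x\<close>. Since such a pair is unique, each
  crossed group axiom only requires that composites of such pairs are again such pairs.

  A crossed subgroup \<open>K\<close> is detected in degrees 0, 1 and 2. An element with \<open>\<theta> = -1\<close> pulls back to the
  nontrivial element of \<open>K(0)\<close>, whose pullbacks are the reversals \<open>(\<rho>; -1, \<dots>, -1; -1)\<close>; so \<open>K\<close> is
  determined by its elements with \<open>\<theta> = 1\<close> and by whether it contains the reversals. Among the elements
  with \<open>\<theta> = 1\<close>, a sign \<open>-1\<close> pulls back to the nontrivial element of \<open>H\<^sub>1\<close>, whose pullbacks generate all
  \<open>H\<^sub>m\<close>. If there is no sign \<open>-1\<close>, an inversion pulls back to the transposition in \<open>\<SS>\<^sub>2\<close>, whose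
  pullbacks include all adjacent transpositions.
\<close>

declare One_nat_def [simp del]

section \<open>Finite linear orders\<close>

text \<open>Pigeonhole: \<open>\<rho>\<close> cannot map the elements up to \<open>i\<close>
  injectively into those strictly below \<open>i\<close>. So some \<open>k \<le> i\<close> has
  \<open>i \<le> \<rho> k\<close>, and \<open>f i \<le> f (\<rho> k) = g k \<le> g i\<close> by
  monotonicity.\<close>

lemma mono_rearrangement_le:
  fixes f :: "'a::linorder \<Rightarrow> 'b::order"
  assumes "finite X" "inj_on \<rho> X" "\<rho> ` X = X" "mono_on X f" "mono_on X g"
    and "\<And>k. k \<in> X \<Longrightarrow> g k = f (\<rho> k)" "i \<in> X"
  shows "f i \<le> g i"
proof -
  have "\<exists>k\<in>X. k \<le> i \<and> i \<le> \<rho> k"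
  proof (rule ccontr)
    assume "\<not> ?thesis"
    then have "\<rho> ` {k \<in> X. k \<le> i} \<subseteq> {k \<in> X. k < i}"
      using assms(3) by auto
    then have "card {k \<in> X. k \<le> i} \<le> card {k \<in> X. k < i}"
      using assms(1,2) by (intro card_inj_on_le[of \<rho>]) (auto intro: inj_on_subset)
    moreover have "{k \<in> X. k < i} \<subset> {k \<in> X. k \<le> i}"
      using \<open>i \<in> X\<close> by force
    ultimately show False
      using psubset_card_mono[of "{k \<in> X. k \<le> i}" "{k \<in> X. k < i}"] assms(1) by simp
  qed
  then obtain k where k: "k \<in> X" "k \<le> i" "i \<le> \<rho> k" by blast
  have "f i \<le> f (\<rho> k)"
    using assms k by (intro mono_onD[OF assms(4)]) auto
  also have "\<dots> = g k" using assms(6) k by simp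
  also have "\<dots> \<le> g i"
    using assms k by (intro mono_onD[OF assms(5)]) auto
  finally show ?thesis .
qed

text \<open>Each of \<open>f\<close> and \<open>g\<close> is a rearrangement of the other, through
  \<open>\<tau> \<circ> inv_into X \<tau>'\<close> and its inverse, so the previous inequality holds
  both ways. The uniqueness of \<phi>^x rests on this.\<close>

lemma mono_rearrangement_eq:
  fixes f :: "'a::linorder \<Rightarrow> 'b::order"
  assumes X: "finite X" and \<tau>: "bij_betw \<tau> X X" "bij_betw \<tau>' X X"
    and mono: "mono_on X f" "mono_on X g"
    and eq: "\<And>k. k \<in> X \<Longrightarrow> f (\<tau> k) = g (\<tau>' k)" and "i \<in> X"
  shows "f i = g i"
proof (rule antisym)
  have inj: "inj_on (\<tau> \<circ> inv_into X \<tau>') X" "(\<tau> \<circ> inv_into X \<tau>') ` X = X"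
    "inj_on (\<tau>' \<circ> inv_into X \<tau>) X" "(\<tau>' \<circ> inv_into X \<tau>) ` X = X"
    using \<tau> by (metis bij_betw_def bij_betw_inv_into bij_betw_trans)+
  have 1: "g k = f ((\<tau> \<circ> inv_into X \<tau>') k)" if "k \<in> X" for k
    using eq[of "inv_into X \<tau>' k"] that \<tau>(2)
    by (simp add: bij_betw_inv_into_right bij_betw_def inv_into_into f_inv_into_f)
  have 2: "f k = g ((\<tau>' \<circ> inv_into X \<tau>) k)" if "k \<in> X" for k
    using eq[of "inv_into X \<tau> k"] that \<tau>(1)
    by (simp add: bij_betw_inv_into_right bij_betw_def inv_into_into f_inv_into_f)
  show "f i \<le> g i"
    by (rule mono_rearrangement_le[OF X inj(1,2) mono 1 \<open>i \<in> X\<close>])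
  show "g i \<le> f i"
    by (rule mono_rearrangement_le[OF X inj(3,4) mono(2,1) 2 \<open>i \<in> X\<close>])
qed

text \<open>The hypothesis makes \<open>\<tau>' \<circ> inv_into X \<tau>\<close> monotone on
  \<open>X\<close>. Being also a rearrangement of the identity, it is the identity.\<close>

lemma order_iso_unique:
  fixes X :: "'a::linorder set"
  assumes X: "finite X" and \<tau>: "bij_betw \<tau> X X" "bij_betw \<tau>' X X"
    and less: "\<And>j k. j \<in> X \<Longrightarrow> k \<in> X \<Longrightarrow> \<tau> j < \<tau> k \<Longrightarrow> \<tau>' j < \<tau>' k"
    and "i \<in> X"
  shows "\<tau> i = \<tau>' i"
proof -
  define g where "g = \<tau>' \<circ> inv_into X \<tau>"
  have g: "g (\<tau> k) = \<tau>' k" if "k \<in> X" for k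
    using that \<tau>(1) by (simp add: g_def bij_betw_inv_into_left)
  have "mono_on X g"
  proof (rule mono_onI)
    fix a b assume ab: "a \<in> X" "b \<in> X" "a \<le> b"
    then obtain j k where "a = \<tau> j" "b = \<tau> k" "j \<in> X" "k \<in> X"
      using \<tau>(1) by (metis bij_betw_iff_bijections)
    then show "g a \<le> g b"
      using less[of j k] ab g by (cases "a = b") (auto simp: less_le)
  qed
  moreover have "mono_on X (\<lambda>k. k)" by (auto intro: mono_onI)
  ultimately have "\<tau> i = g (\<tau> i)"
    using \<tau> g \<open>i \<in> X\<close> bij_betwE
    by (intro mono_rearrangement_eq[OF X \<tau>(2) \<tau>(1), where f = "\<lambda>k. k" and g = g]) (auto simp: g)
  then show ?thesis using g \<open>i \<in> X\<close> by simp
qed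

text \<open>Sorting by rank: \<open>r j\<close> counts the elements with a smaller
  \<open>f\<close>-value and serves as a 0-based index into the increasing enumeration of
  \<open>X\<close>.\<close>

lemma sorting_bijection_exists:
  fixes X :: "'a::linorder set" and f :: "'a \<Rightarrow> 'b::linorder"
  assumes X: "finite X" and inj: "inj_on f X"
  obtains \<tau> where "bij_betw \<tau> X X" "\<And>i j. i \<in> X \<Longrightarrow> j \<in> X \<Longrightarrow> f i < f j \<Longrightarrow> \<tau> i < \<tau> j"
proof -
  define r where "r j = card {k \<in> X. f k < f j}" for j
  define \<tau> where "\<tau> j = sorted_list_of_set X ! r j" for j
  have bound: "r j < card X" if "j \<in> X" for j
    unfolding r_def using X that by (intro psubset_card_mono) auto
  have r_less: "r i < r j" if "i \<in> X" "j \<in> X" "f i < f j" for i j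
    unfolding r_def using X that by (intro psubset_card_mono) auto
  have less: "\<tau> i < \<tau> j" if "i \<in> X" "j \<in> X" "f i < f j" for i j
    unfolding \<tau>_def
    using r_less[OF that] bound[OF that(2)]
    by (intro sorted_wrt_nth_less[OF strict_sorted_list_of_set]) auto
  have "\<tau> ` X \<subseteq> X"
  proof
    fix y assume "y \<in> \<tau> ` X"
    then obtain j where "j \<in> X" "y = \<tau> j" by blast
    then show "y \<in> X"
      using bound[of j] nth_mem[of "r j" "sorted_list_of_set X"] X by (simp add: \<tau>_def)
  qed
  moreover have "inj_on \<tau> X"
  proof (rule inj_onI)
    fix i j assume "i \<in> X" "j \<in> X" "\<tau> i = \<tau> j"
    then show "i = j"
      using less[of i j] less[of j i] inj_onD[OF inj, of i j]
      by (cases "f i" "f j" rule: linorder_cases) auto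
  qed
  ultimately have "bij_betw \<tau> X X"
    using X by (simp add: bij_betw_def endo_inj_surj)
  with less show thesis by (rule that[rotated])
qed

section \<open>Intervals and the Weyl groups\<close>

lemma finite_interval [simp]: "finite (interval n)"
  by (simp add: interval_def)

lemma interval_simps [simp]:
  "Minf \<in> interval n" "Pinf \<in> interval n" "Fin i \<in> interval n \<longleftrightarrow> i \<in> {1..n}"
  by (auto simp: interval_def)

lemma interval_cases [consumes 1, case_names Minf Pinf Fin]:
  assumes "j \<in> interval n"
  obtains "j = Minf" | "j = Pinf" | i where "j = Fin i" "i \<in> {1..n}"
  using assms by (auto simp: interval_def)

section \<open>Morphisms of intervals\<close>

lemma nabla_sel [simp]:
  "Obj nabla = UNIV" "Ident nabla n = restrict id (interval n)"
  "Comp nabla l m n \<psi> \<phi> = compose (interval l) \<psi> \<phi>"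
  by (simp_all add: nabla_def)

lemma Hom_nabla_iff:
  "\<phi> \<in> Hom nabla m n \<longleftrightarrow> \<phi> \<in> interval m \<rightarrow>\<^sub>E interval n \<and> mono_on (interval m) \<phi>
    \<and> \<phi> Minf = Minf \<and> \<phi> Pinf = Pinf"
  by (simp add: nabla_def)

lemma Hom_nabla_mem: "\<phi> \<in> Hom nabla m n \<Longrightarrow> j \<in> interval m \<Longrightarrow> \<phi> j \<in> interval n"
  by (auto simp: Hom_nabla_iff)

lemma Hom_nabla_mono:
  "\<phi> \<in> Hom nabla m n \<Longrightarrow> j \<in> interval m \<Longrightarrow> k \<in> interval m \<Longrightarrow> j \<le> k \<Longrightarrow> \<phi> j \<le> \<phi> k"
  unfolding Hom_nabla_iff using mono_onD[of "interval m" \<phi> j k] by blast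

lemma Hom_nabla_ends:
  "\<phi> \<in> Hom nabla m n \<Longrightarrow> \<phi> Minf = Minf" "\<phi> \<in> Hom nabla m n \<Longrightarrow> \<phi> Pinf = Pinf"
  by (auto simp: Hom_nabla_iff)

lemma Ident_nabla_Hom [simp]: "restrict id (interval n) \<in> Hom nabla n n"
  by (auto simp: Hom_nabla_iff intro: mono_onI)

lemma compose_nabla_Hom [simp]:
  assumes "\<phi> \<in> Hom nabla l m" "\<psi> \<in> Hom nabla m n"
  shows "compose (interval l) \<psi> \<phi> \<in> Hom nabla l n"
  unfolding Hom_nabla_iff
proof (intro conjI mono_onI)
  show "compose (interval l) \<psi> \<phi> \<in> interval l \<rightarrow>\<^sub>E interval n"
    using assms Hom_nabla_mem by (simp add: compose_def)
  show "compose (interval l) \<psi> \<phi> i \<le> compose (interval l) \<psi> \<phi> j"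
    if "i \<in> interval l" "j \<in> interval l" "i \<le> j" for i j
    using that assms Hom_nabla_mono[OF assms(2), of "\<phi> i" "\<phi> j"]
    by (simp add: compose_def Hom_nabla_mono[OF assms(1)] Hom_nabla_mem[OF assms(1)])
qed (use assms in \<open>simp_all add: compose_def Hom_nabla_iff\<close>)

lemma small_category_nabla: "small_category nabla"
proof
  show "Comp nabla a a b \<phi> (Ident nabla a) = \<phi>" if "\<phi> \<in> Hom nabla a b" for a b \<phi>
    using that by (auto simp: Hom_nabla_iff compose_def PiE_def extensional_def fun_eq_iff)
  show "Comp nabla a b b (Ident nabla b) \<phi> = \<phi>" if "\<phi> \<in> Hom nabla a b" for a b \<phi>
    using that by (auto simp: Hom_nabla_iff compose_def PiE_def extensional_def fun_eq_iff)
  show "Comp nabla a c d \<chi> (Comp nabla a b c \<psi> \<phi>) = Comp nabla a b d (Comp nabla b c d \<chi> \<psi>) \<phi>"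
    if "\<phi> \<in> Hom nabla a b" for a b c d \<phi> \<psi> \<chi>
    using that Hom_nabla_mem[OF that] by (auto simp: compose_def fun_eq_iff)
qed auto

section \<open>Group structure of the Weyl groups\<close>

lemma weyl_elt_cases:
  obtains \<sigma> \<epsilon> \<theta> where "x = ((\<sigma>, \<epsilon>), \<theta> :: int)"
  by (cases x) auto

lemma weyl_carrier_iff:
  "((\<sigma>, \<epsilon>), \<theta>) \<in> carrier (weyl_group n) \<longleftrightarrow>
    \<sigma> permutes {1..n} \<and> \<epsilon> \<in> {1..n} \<rightarrow>\<^sub>E {-1, 1} \<and> (\<theta> = -1 \<or> \<theta> = 1)"
  by (simp add: weyl_group_def hyperoctahedral_group_def sym_group_def sign_img_def)

lemma weyl_mult:
  "((\<sigma>, \<epsilon>), \<theta>) \<otimes>\<^bsub>weyl_group n\<^esub> ((\<tau>, \<zeta>), \<eta>) = ((\<sigma> \<circ> \<tau>, \<lambda>i\<in>{1..n}. \<epsilon> (\<tau> i) * \<zeta> i), \<theta> * \<eta>)"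
  by (simp add: weyl_group_def hyperoctahedral_group_def sign_img_def)

lemma weyl_one: "\<one>\<^bsub>weyl_group n\<^esub> = ((id, \<lambda>i\<in>{1..n}. 1), 1)"
  by (simp add: weyl_group_def hyperoctahedral_group_def sign_img_def)

lemma sign_PiE: "\<epsilon> \<in> {1..n} \<rightarrow>\<^sub>E {-1, 1} \<Longrightarrow> i \<in> {1..n} \<Longrightarrow> \<epsilon> i = -1 \<or> \<epsilon> i = (1::int)"
  by (auto dest!: PiE_mem[where x = i])

lemma weyl_mult_carrier:
  assumes "x \<in> carrier (weyl_group n)" "y \<in> carrier (weyl_group n)"
  shows "x \<otimes>\<^bsub>weyl_group n\<^esub> y \<in> carrier (weyl_group n)"
proof -
  obtain \<sigma> \<epsilon> \<theta> where [simp]: "x = ((\<sigma>, \<epsilon>), \<theta>)" by (rule weyl_elt_cases)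
  obtain \<tau> \<zeta> \<eta> where [simp]: "y = ((\<tau>, \<zeta>), \<eta>)" by (rule weyl_elt_cases)
  have "\<epsilon> (\<tau> i) * \<zeta> i = -1 \<or> \<epsilon> (\<tau> i) * \<zeta> i = 1" if "i \<in> {1..n}" for i
    using assms that sign_PiE[of \<epsilon> n "\<tau> i"] sign_PiE[of \<zeta> n i] permutes_in_image[of \<tau> "{1..n}" i]
    unfolding \<open>x = _\<close> \<open>y = _\<close> weyl_carrier_iff by auto
  then show ?thesis
    using assms by (auto simp: weyl_carrier_iff weyl_mult permutes_compose)
qed

text \<open>Moving the signs along \<open>inv' \<sigma>\<close> makes the twisted product pair each
  \<open>\<epsilon> i\<close> with itself, and signs square to 1.\<close>

lemma weyl_inverse:
  assumes "((\<sigma>, \<epsilon>), \<theta>) \<in> carrier (weyl_group n)"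
  shows "((inv' \<sigma>, \<lambda>i\<in>{1..n}. \<epsilon> (inv' \<sigma> i)), \<theta>) \<in> carrier (weyl_group n)"
    and "((inv' \<sigma>, \<lambda>i\<in>{1..n}. \<epsilon> (inv' \<sigma> i)), \<theta>) \<otimes>\<^bsub>weyl_group n\<^esub> ((\<sigma>, \<epsilon>), \<theta>) = \<one>\<^bsub>weyl_group n\<^esub>"
proof -
  have \<sigma>: "\<sigma> permutes {1..n}" "inv' \<sigma> permutes {1..n}"
    using assms permutes_inv by (auto simp: weyl_carrier_iff)
  have sgn: "\<epsilon> i = -1 \<or> \<epsilon> i = 1" if "i \<in> {1..n}" for i
    using assms that sign_PiE unfolding weyl_carrier_iff by blast
  show "((inv' \<sigma>, \<lambda>i\<in>{1..n}. \<epsilon> (inv' \<sigma> i)), \<theta>) \<in> carrier (weyl_group n)"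
    using assms \<sigma> sgn permutes_in_image[OF \<sigma>(2)] by (auto simp: weyl_carrier_iff)
  have "(\<lambda>i\<in>{1..n}. \<epsilon> (inv' \<sigma> i)) (\<sigma> i) * \<epsilon> i = 1" if "i \<in> {1..n}" for i
    using that sgn[OF that] permutes_in_image[OF \<sigma>(1), of i] permutes_inverses(2)[OF \<sigma>(1)] by auto
  then show "((inv' \<sigma>, \<lambda>i\<in>{1..n}. \<epsilon> (inv' \<sigma> i)), \<theta>) \<otimes>\<^bsub>weyl_group n\<^esub> ((\<sigma>, \<epsilon>), \<theta>) = \<one>\<^bsub>weyl_group n\<^esub>"
    unfolding weyl_mult weyl_one using assms permutes_inv_o(2)[OF \<sigma>(1)]
    by (auto simp: weyl_carrier_iff fun_eq_iff)
qed

lemma group_weyl_group: "group (weyl_group n)"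
proof (rule groupI)
  show "\<one>\<^bsub>weyl_group n\<^esub> \<in> carrier (weyl_group n)"
    by (simp add: weyl_one weyl_carrier_iff permutes_id)
  show "\<one>\<^bsub>weyl_group n\<^esub> \<otimes>\<^bsub>weyl_group n\<^esub> x = x" if "x \<in> carrier (weyl_group n)" for x
  proof -
    obtain \<sigma> \<epsilon> \<theta> where x: "x = ((\<sigma>, \<epsilon>), \<theta>)" by (rule weyl_elt_cases)
    have "\<sigma> i \<in> {1..n}" if "i \<in> {1..n}" for i
      using \<open>x \<in> _\<close> that permutes_in_image[of \<sigma> "{1..n}" i] unfolding x weyl_carrier_iff by auto
    with that show ?thesis
      unfolding x weyl_one weyl_mult weyl_carrier_iff by (auto simp: fun_eq_iff PiE_def extensional_def)
  qed
  show "x \<otimes>\<^bsub>weyl_group n\<^esub> y \<otimes>\<^bsub>weyl_group n\<^esub> z = x \<otimes>\<^bsub>weyl_group n\<^esub> (y \<otimes>\<^bsub>weyl_group n\<^esub> z)"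
    if "z \<in> carrier (weyl_group n)" for x y z
  proof -
    obtain \<sigma> \<epsilon> \<theta> where x: "x = ((\<sigma>, \<epsilon>), \<theta>)" by (rule weyl_elt_cases)
    obtain \<tau> \<zeta> \<eta> where y: "y = ((\<tau>, \<zeta>), \<eta>)" by (rule weyl_elt_cases)
    obtain \<upsilon> \<xi> \<iota> where z: "z = ((\<upsilon>, \<xi>), \<iota>)" by (rule weyl_elt_cases)
    note xyz = x y z
    have "\<upsilon> i \<in> {1..n}" if "i \<in> {1..n}" for i
      using \<open>z \<in> _\<close> that permutes_in_image[of \<upsilon> "{1..n}" i] unfolding xyz weyl_carrier_iff by auto
    then show ?thesis
      unfolding xyz weyl_mult by (auto simp: fun_eq_iff mult.assoc restrict_def)
  qed
  show "\<exists>y\<in>carrier (weyl_group n). y \<otimes>\<^bsub>weyl_group n\<^esub> x = \<one>\<^bsub>weyl_group n\<^esub>"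
    if "x \<in> carrier (weyl_group n)" for x
    using weyl_inverse that by (cases x rule: weyl_elt_cases) blast
qed (rule weyl_mult_carrier)

lemma weyl_inv:
  assumes "((\<sigma>, \<epsilon>), \<theta>) \<in> carrier (weyl_group n)"
  shows "inv\<^bsub>weyl_group n\<^esub> ((\<sigma>, \<epsilon>), \<theta>) = ((inv' \<sigma>, \<lambda>i\<in>{1..n}. \<epsilon> (inv' \<sigma> i)), \<theta>)"
  using group.inv_equality[OF group_weyl_group weyl_inverse(2)[OF assms] assms weyl_inverse(1)[OF assms]] .

section \<open>Permutations and signs on the interval\<close>

lemma snd_weyl_mult [simp]: "snd (x \<otimes>\<^bsub>weyl_group n\<^esub> y) = snd x * snd y"
  by (cases x rule: weyl_elt_cases; cases y rule: weyl_elt_cases) (simp add: weyl_mult)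

lemma snd_weyl_cases: "x \<in> carrier (weyl_group n) \<Longrightarrow> snd x = -1 \<or> snd x = 1"
  by (cases x rule: weyl_elt_cases) (simp add: weyl_carrier_iff)

lemma weyl_sign_ends [simp]: "weyl_sign x Minf = snd x" "weyl_sign x Pinf = snd x"
  by (cases x rule: weyl_elt_cases; simp)+

lemma weyl_sign_cases:
  "x \<in> carrier (weyl_group n) \<Longrightarrow> i \<in> interval n \<Longrightarrow> weyl_sign x i = -1 \<or> weyl_sign x i = 1"
  by (cases "(x, i)" rule: weyl_sign.cases)
    (auto simp: weyl_carrier_iff interval_def dest: sign_PiE)

lemma weyl_perm_bij:
  assumes "x \<in> carrier (weyl_group n)"
  shows "bij_betw (weyl_perm x) (interval n) (interval n)"
proof -
  obtain \<sigma> \<epsilon> \<theta> where x: "x = ((\<sigma>, \<epsilon>), \<theta>)" by (rule weyl_elt_cases)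
  have \<sigma>: "\<sigma> permutes {1..n}" using assms by (simp add: x weyl_carrier_iff)
  have "inj_on (weyl_perm x) (interval n)"
    using inj_eq[OF permutes_inj[OF \<sigma>]] by (auto simp: inj_on_def x interval_def)
  moreover have "weyl_perm x ` interval n \<subseteq> interval n"
    using permutes_in_image[OF \<sigma>] by (auto simp: x interval_def)
  ultimately show ?thesis by (simp add: bij_betw_def endo_inj_surj)
qed

lemma weyl_perm_mem:
  "x \<in> carrier (weyl_group n) \<Longrightarrow> i \<in> interval n \<Longrightarrow> weyl_perm x i \<in> interval n"
  using weyl_perm_bij bij_betwE by blast

lemma weyl_perm_inject:
  "x \<in> carrier (weyl_group n) \<Longrightarrow> i \<in> interval n \<Longrightarrow> j \<in> interval n \<Longrightarrow>
    weyl_perm x i = weyl_perm x j \<longleftrightarrow> i = j"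
  using weyl_perm_bij[of x n] by (auto simp: bij_betw_def inj_on_eq_iff)

lemma weyl_perm_ends:
  "snd x = 1 \<Longrightarrow> weyl_perm x Minf = Minf" "snd x = 1 \<Longrightarrow> weyl_perm x Pinf = Pinf"
  "snd x = -1 \<Longrightarrow> weyl_perm x Minf = Pinf" "snd x = -1 \<Longrightarrow> weyl_perm x Pinf = Minf"
  by (cases x rule: weyl_elt_cases; simp)+

lemma weyl_perm_mult:
  "weyl_perm (x \<otimes>\<^bsub>weyl_group n\<^esub> y) i = weyl_perm x (weyl_perm y i)"
  if "x \<in> carrier (weyl_group n)" "y \<in> carrier (weyl_group n)"
  using that
  by (cases "(x, i)" rule: weyl_perm.cases; cases "(y, i)" rule: weyl_perm.cases)
    (auto simp: weyl_mult weyl_carrier_iff)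

text \<open>The twisted product read as a cocycle identity. It extends to the endpoints because
  \<open>weyl_perm y\<close> maps endpoints to endpoints and both carry the same sign.\<close>

lemma weyl_sign_mult:
  "weyl_sign (x \<otimes>\<^bsub>weyl_group n\<^esub> y) i = weyl_sign x (weyl_perm y i) * weyl_sign y i"
  if "i \<in> interval n"
  using that
  by (cases "(x, i)" rule: weyl_perm.cases; cases "(y, i)" rule: weyl_perm.cases)
    (auto simp: weyl_mult)

lemma weyl_perm_one [simp]: "weyl_perm \<one>\<^bsub>weyl_group n\<^esub> i = i"
  by (cases i) (auto simp: weyl_one)

lemma weyl_sign_one [simp]: "i \<in> interval n \<Longrightarrow> weyl_sign \<one>\<^bsub>weyl_group n\<^esub> i = 1"
  by (cases i) (auto simp: weyl_one)

text \<open>Values on the interval suffice: outside \<open>{1..n}\<close> the permutation is the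
  identity and the sign vector is \<open>undefined\<close>, while \<theta> is the sign at
  \<open>Minf\<close>.\<close>

lemma weyl_eqI:
  assumes "x \<in> carrier (weyl_group n)" "y \<in> carrier (weyl_group n)"
    and perm: "\<And>i. i \<in> interval n \<Longrightarrow> weyl_perm x i = weyl_perm y i"
    and sgn: "\<And>i. i \<in> interval n \<Longrightarrow> weyl_sign x i = weyl_sign y i"
  shows "x = y"
proof -
  obtain \<sigma> \<epsilon> \<theta> where x: "x = ((\<sigma>, \<epsilon>), \<theta>)" by (rule weyl_elt_cases)
  obtain \<tau> \<zeta> \<eta> where y: "y = ((\<tau>, \<zeta>), \<eta>)" by (rule weyl_elt_cases)
  note xy = x y
  have "\<sigma> i = \<tau> i" for i
    using perm[of "Fin i"] assms(1,2) permutes_not_in[of \<sigma> "{1..n}" i] permutes_not_in[of \<tau> "{1..n}" i]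
    unfolding xy weyl_carrier_iff by (cases "i \<in> {1..n}") auto
  moreover have "\<epsilon> = \<zeta>"
    using assms(1,2) sgn[of "Fin _"] unfolding xy weyl_carrier_iff
    by (intro PiE_ext[of \<epsilon> "{1..n}" "\<lambda>_. {-1,1}" \<zeta>]) auto
  moreover have "\<theta> = \<eta>" using sgn[of Minf] by (simp add: xy)
  ultimately show ?thesis by (auto simp: xy)
qed

text \<open>Once the two endpoints are fixed or exchanged, injectivity keeps interior points in the
  interior, which gives \<sigma>. The behaviour at the endpoints dictates \<theta>, and the interior
  signs are free.\<close>

lemma weyl_perm_realize:
  assumes \<tau>: "bij_betw \<tau> (interval n) (interval n)"
    and \<theta>: "\<theta> = 1 \<and> \<tau> Minf = Minf \<and> \<tau> Pinf = Pinf \<or> \<theta> = -1 \<and> \<tau> Minf = Pinf \<and> \<tau> Pinf = Minf"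
    and \<epsilon>: "\<And>i. i \<in> {1..n} \<Longrightarrow> \<epsilon> i = -1 \<or> \<epsilon> i = 1"
  obtains x where "x \<in> carrier (weyl_group n)" "snd x = \<theta>"
    "\<And>i. i \<in> interval n \<Longrightarrow> weyl_perm x i = \<tau> i" "\<And>i. i \<in> {1..n} \<Longrightarrow> weyl_sign x (Fin i) = \<epsilon> i"
proof -
  have inj: "\<tau> i = \<tau> j \<longleftrightarrow> i = j" if "i \<in> interval n" "j \<in> interval n" for i j
    using that \<tau> by (auto simp: bij_betw_def inj_on_eq_iff)
  have "\<exists>k\<in>{1..n}. \<tau> (Fin i) = Fin k" if "i \<in> {1..n}" for i
  proof -
    have "\<tau> (Fin i) \<in> interval n" using that \<tau> bij_betwE by fastforce
    moreover have "\<tau> (Fin i) \<noteq> \<tau> Minf" "\<tau> (Fin i) \<noteq> \<tau> Pinf" using that by (simp_all add: inj)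
    ultimately show ?thesis using \<theta> by (auto simp: interval_def)
  qed
  then obtain \<sigma>0 where \<sigma>0: "\<And>i. i \<in> {1..n} \<Longrightarrow> \<sigma>0 i \<in> {1..n} \<and> \<tau> (Fin i) = Fin (\<sigma>0 i)"
    by metis
  define \<sigma> where "\<sigma> i = (if i \<in> {1..n} then \<sigma>0 i else i)" for i
  have "inj_on \<sigma>0 {1..n}"
    using \<sigma>0 inj by (metis inj_onI interval_simps(3) extended.inject)
  then have "bij_betw \<sigma>0 {1..n} {1..n}"
    using \<sigma>0 by (auto simp: bij_betw_def endo_inj_surj image_subset_iff)
  then have "bij_betw \<sigma> {1..n} {1..n}"
    by (subst bij_betw_cong[of _ _ \<sigma>0]) (auto simp: \<sigma>_def)
  then have \<sigma>: "\<sigma> permutes {1..n}"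
    by (rule bij_imp_permutes) (auto simp: \<sigma>_def)
  show thesis
  proof (rule that[of "((\<sigma>, \<lambda>i\<in>{1..n}. \<epsilon> i), \<theta>)"])
    show "((\<sigma>, \<lambda>i\<in>{1..n}. \<epsilon> i), \<theta>) \<in> carrier (weyl_group n)"
      using \<sigma> \<epsilon> \<theta> by (auto simp: weyl_carrier_iff)
    show "weyl_perm ((\<sigma>, \<lambda>i\<in>{1..n}. \<epsilon> i), \<theta>) i = \<tau> i" if "i \<in> interval n" for i
      using that \<theta> by (cases rule: interval_cases) (auto simp: \<sigma>_def \<sigma>0)
  qed auto
qed

section \<open>Crossings\<close>

text \<open>
  \<open>weyl_crossing m n \<phi> x \<phi>' y\<close> says that \<open>\<phi>' = \<phi>\<^sup>x\<close> and \<open>y = \<phi>\<^sup>*(x)\<close>. This relation is functional in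
  \<open>(\<phi>, x)\<close> and closed under both compositions, which yields all the axioms of a crossed group.
\<close>

definition weyl_crossing ::
    "nat \<Rightarrow> nat \<Rightarrow> (nat extended \<Rightarrow> nat extended) \<Rightarrow> weyl_elt \<Rightarrow> (nat extended \<Rightarrow> nat extended) \<Rightarrow> weyl_elt \<Rightarrow> bool"
  where
  "weyl_crossing m n \<phi> x \<phi>' y \<longleftrightarrow>
     \<phi> \<in> Hom nabla m n \<and> x \<in> carrier (weyl_group n) \<and>
     \<phi>' \<in> Hom nabla m n \<and> y \<in> carrier (weyl_group m) \<and>
     (\<forall>j\<in>interval m. weyl_perm x (\<phi> j) = \<phi>' (weyl_perm y j)) \<and>
     (\<forall>j\<in>interval m. weyl_sign y j = weyl_sign x (\<phi> j)) \<and>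
     (\<forall>j\<in>interval m. \<forall>k\<in>interval m. j < k \<longrightarrow> \<phi> j = \<phi> k \<longrightarrow>
        (if weyl_sign x (\<phi> j) = 1 then weyl_perm y j < weyl_perm y k
         else weyl_perm y k < weyl_perm y j))"

lemma weyl_crossingD:
  assumes "weyl_crossing m n \<phi> x \<phi>' y"
  shows "\<phi> \<in> Hom nabla m n" "x \<in> carrier (weyl_group n)"
    "\<phi>' \<in> Hom nabla m n" "y \<in> carrier (weyl_group m)"
    "j \<in> interval m \<Longrightarrow> weyl_perm x (\<phi> j) = \<phi>' (weyl_perm y j)"
    "j \<in> interval m \<Longrightarrow> weyl_sign y j = weyl_sign x (\<phi> j)"
    "\<lbrakk>j \<in> interval m; k \<in> interval m; j < k; \<phi> j = \<phi> k; weyl_sign x (\<phi> j) = 1\<rbrakk>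
      \<Longrightarrow> weyl_perm y j < weyl_perm y k"
    "\<lbrakk>j \<in> interval m; k \<in> interval m; j < k; \<phi> j = \<phi> k; weyl_sign x (\<phi> j) = -1\<rbrakk>
      \<Longrightarrow> weyl_perm y k < weyl_perm y j"
  using assms unfolding weyl_crossing_def by auto

section \<open>Uniqueness of crossings\<close>

lemma weyl_crossing_snd:
  assumes "weyl_crossing m n \<phi> x \<phi>' y" shows "snd y = snd x"
  using weyl_crossingD(6)[OF assms, of Minf] Hom_nabla_ends[OF weyl_crossingD(1)[OF assms]] by simp

text \<open>Since \<open>\<phi>'\<close> is monotone, the order between images of different fibres
  is forced by \<pi>_x \<phi>. The signs therefore matter only inside a fibre.\<close>

lemma weyl_crossing_less:
  assumes cr: "weyl_crossing m n \<phi> x \<phi>' y" and jk: "j \<in> interval m" "k \<in> interval m"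
    and less: "weyl_perm x (\<phi> j) < weyl_perm x (\<phi> k)"
  shows "weyl_perm y j < weyl_perm y k"
proof (rule ccontr)
  assume "\<not> ?thesis"
  then have "\<phi>' (weyl_perm y k) \<le> \<phi>' (weyl_perm y j)"
    using weyl_crossingD(3,4)[OF cr] jk by (intro Hom_nabla_mono[of \<phi>' m n]) (auto intro: weyl_perm_mem)
  then show False
    using less weyl_crossingD(5)[OF cr] jk by simp
qed

text \<open>Both candidates are monotone rearrangements of the same function \<pi>_x \<phi>.\<close>

lemma weyl_act_unique:
  assumes "x \<in> carrier (weyl_group n)" "\<phi> \<in> Hom nabla m n"
    and \<phi>': "\<phi>' \<in> interval m \<rightarrow>\<^sub>E interval n" "mono_on (interval m) \<phi>'"
      "\<tau>' permutes interval m" "\<And>j. j \<in> interval m \<Longrightarrow> weyl_perm x (\<phi> j) = \<phi>' (\<tau>' j)"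
    and \<phi>'': "\<phi>'' \<in> interval m \<rightarrow>\<^sub>E interval n" "mono_on (interval m) \<phi>''"
      "\<tau>'' permutes interval m" "\<And>j. j \<in> interval m \<Longrightarrow> weyl_perm x (\<phi> j) = \<phi>'' (\<tau>'' j)"
  shows "\<phi>' = \<phi>''"
proof (rule PiE_ext[OF \<phi>'(1) \<phi>''(1)])
  show "\<phi>' i = \<phi>'' i" if "i \<in> interval m" for i
    by (rule mono_rearrangement_eq[OF finite_interval permutes_imp_bij[OF \<phi>'(3)]
          permutes_imp_bij[OF \<phi>''(3)] \<phi>'(2) \<phi>''(2) _ that])
      (use \<phi>'(4) \<phi>''(4) in force)
qed

lemma weyl_act_eq:
  assumes cr: "weyl_crossing m n \<phi> x \<phi>' y"
  shows "weyl_act m n x \<phi> = \<phi>'"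
proof -
  \<comment> \<open>The permutation of \<open>y\<close> in the form that \<open>permutes\<close>
    asks for: a bijection of the interval and the identity outside it.\<close>
  define \<tau> where "\<tau> j = (if j \<in> interval m then weyl_perm y j else j)" for j
  have "bij_betw \<tau> (interval m) (interval m)"
    using weyl_perm_bij[OF weyl_crossingD(4)[OF cr]]
    by (subst bij_betw_cong[of _ _ "weyl_perm y"]) (auto simp: \<tau>_def)
  then have \<tau>: "\<tau> permutes interval m"
    by (rule bij_imp_permutes) (auto simp: \<tau>_def)
  show ?thesis
    unfolding weyl_act_def
  proof (rule the_equality)
    show *: "\<phi>' \<in> interval m \<rightarrow>\<^sub>E interval n \<and> mono_on (interval m) \<phi>' \<and>
        (\<exists>\<tau>. \<tau> permutes interval m \<and> (\<forall>j\<in>interval m. weyl_perm x (\<phi> j) = \<phi>' (\<tau> j)))"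
      using \<tau> weyl_crossingD(3,5)[OF cr] by (intro conjI exI[of _ \<tau>]) (auto simp: Hom_nabla_iff \<tau>_def)
    fix \<phi>''
    assume "\<phi>'' \<in> interval m \<rightarrow>\<^sub>E interval n \<and> mono_on (interval m) \<phi>'' \<and>
        (\<exists>\<tau>. \<tau> permutes interval m \<and> (\<forall>j\<in>interval m. weyl_perm x (\<phi> j) = \<phi>'' (\<tau> j)))"
    then obtain \<tau>'' where "\<phi>'' \<in> interval m \<rightarrow>\<^sub>E interval n" "mono_on (interval m) \<phi>''"
        "\<tau>'' permutes interval m" "\<And>j. j \<in> interval m \<Longrightarrow> weyl_perm x (\<phi> j) = \<phi>'' (\<tau>'' j)"
      by blast
    moreover have "weyl_perm x (\<phi> j) = \<phi>' (\<tau> j)" if "j \<in> interval m" for j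
      using that weyl_crossingD(5)[OF cr] by (simp add: \<tau>_def)
    ultimately show "\<phi>'' = \<phi>'"
      using * \<tau> by (intro weyl_act_unique[OF weyl_crossingD(2,1)[OF cr], of \<phi>'' \<tau>'' \<phi>' \<tau>]) auto
  qed
qed

text \<open>The permutations of \<open>y\<close> and \<open>z\<close> order the points alike: across
  fibres both follow \<pi>_x \<phi>, and inside a fibre both follow the sign of \<open>x\<close>
  there. Then \<open>order_iso_unique\<close> identifies them.\<close>

lemma weyl_crossing_unique:
  assumes cr: "weyl_crossing m n \<phi> x \<phi>' y" "weyl_crossing m n \<phi> x \<phi>'' z"
  shows "\<phi>'' = \<phi>'" "z = y"
proof -
  show "\<phi>'' = \<phi>'" using cr weyl_act_eq by blast
  show "z = y"
  proof (rule weyl_eqI[OF weyl_crossingD(4)[OF cr(2)] weyl_crossingD(4)[OF cr(1)]])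
    fix i assume i: "i \<in> interval m"
    show "weyl_sign z i = weyl_sign y i"
      using weyl_crossingD(6)[OF cr(1) i] weyl_crossingD(6)[OF cr(2) i] by simp
    show "weyl_perm z i = weyl_perm y i"
    proof (rule order_iso_unique[OF finite_interval weyl_perm_bij weyl_perm_bij _ i])
      show "weyl_perm y j < weyl_perm y k"
        if jk: "j \<in> interval m" "k \<in> interval m" and less: "weyl_perm z j < weyl_perm z k" for j k
      proof (rule ccontr)
        assume "\<not> weyl_perm y j < weyl_perm y k"
        with less have "\<not> weyl_perm x (\<phi> j) < weyl_perm x (\<phi> k)" "\<not> weyl_perm x (\<phi> k) < weyl_perm x (\<phi> j)"
          using weyl_crossing_less[OF cr(1)] weyl_crossing_less[OF cr(2)] jk by fastforce+
        then have "\<phi> j = \<phi> k"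
          using weyl_perm_inject[OF weyl_crossingD(2)[OF cr(1)], of "\<phi> j" "\<phi> k"]
            Hom_nabla_mem[OF weyl_crossingD(1)[OF cr(1)]] jk by auto
        with jk less \<open>\<not> weyl_perm y j < weyl_perm y k\<close> show False
          using weyl_crossingD(7,8)[OF cr(1), of j k] weyl_crossingD(7,8)[OF cr(2), of j k]
            weyl_crossingD(7,8)[OF cr(1), of k j] weyl_crossingD(7,8)[OF cr(2), of k j]
            weyl_sign_cases[OF weyl_crossingD(2)[OF cr(1)], of "\<phi> j"]
            Hom_nabla_mem[OF weyl_crossingD(1)[OF cr(1)], of j]
          by (cases j k rule: linorder_cases) auto
      qed
    qed (use weyl_crossingD(4)[OF cr(1)] weyl_crossingD(4)[OF cr(2)] in auto)
  qed
qed

section \<open>Existence of crossings by sorting\<close>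

lemma weyl_crossing_exists:
  assumes \<phi>: "\<phi> \<in> Hom nabla m n" and x: "x \<in> carrier (weyl_group n)"
  obtains \<phi>' y where "weyl_crossing m n \<phi> x \<phi>' y"
proof -
  let ?I = "interval m"
  \<comment> \<open>\<open>y\<close> sorts \<open>key\<close> lexicographically: first by \<open>\<pi>\<^sub>x\<phi>\<close>, then by position, which the sign
    reverses on the fibres where it is \<open>-1\<close>.\<close>
  define pos where "pos j = (case j of Minf \<Rightarrow> 0 | Fin i \<Rightarrow> int i | Pinf \<Rightarrow> int m + 1)" for j
  define key where "key j = (weyl_perm x (\<phi> j), weyl_sign x (\<phi> j) * pos j)" for j
  \<comment> \<open>The values 0 and \<open>int m + 1\<close> place the endpoints strictly outside
    the interior positions; integers allow the sign to negate a position.\<close>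
  have pos: "pos j < pos k" if "j \<in> ?I" "k \<in> ?I" "j < k" for j k
    using that by (auto simp: pos_def interval_def)
  have sgn: "weyl_sign x (\<phi> j) = -1 \<or> weyl_sign x (\<phi> j) = 1" if "j \<in> ?I" for j
    using weyl_sign_cases[OF x Hom_nabla_mem[OF \<phi> that]] .
  have key_less: "key j < key k" if "j \<in> ?I" "k \<in> ?I" "weyl_perm x (\<phi> j) < weyl_perm x (\<phi> k)" for j k
    using that by (simp add: key_def)
  have key_fibre: "if weyl_sign x (\<phi> j) = 1 then key j < key k else key k < key j"
    if "j \<in> ?I" "k \<in> ?I" "j < k" "\<phi> j = \<phi> k" for j k
    using that sgn[of j] pos[of j k] by (auto simp: key_def)
  have key_total: "key j < key k \<or> key k < key j" if jk: "j \<in> ?I" "k \<in> ?I" "j \<noteq> k" for j k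
  proof (cases "\<phi> j = \<phi> k")
    case True
    then show ?thesis
      using jk key_fibre[of j k] key_fibre[of k j] by (cases j k rule: linorder_cases) (auto split: if_splits)
  next
    case False
    then have "weyl_perm x (\<phi> j) \<noteq> weyl_perm x (\<phi> k)"
      using weyl_perm_inject[OF x] Hom_nabla_mem[OF \<phi>] jk by auto
    then show ?thesis using key_less jk by (meson neqE)
  qed
  have "inj_on key ?I"
  proof (rule inj_onI)
    show "j = k" if "j \<in> ?I" "k \<in> ?I" "key j = key k" for j k
      using key_total[of j k] that by auto
  qed
  then obtain \<tau> where \<tau>: "bij_betw \<tau> ?I ?I"
    and \<tau>_less: "\<And>j k. j \<in> ?I \<Longrightarrow> k \<in> ?I \<Longrightarrow> key j < key k \<Longrightarrow> \<tau> j < \<tau> k"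
    by (rule sorting_bijection_exists[OF finite_interval]) blast
  have \<tau>_mem: "\<tau> j \<in> ?I" if "j \<in> ?I" for j using \<tau> that bij_betwE by blast
  have key_le: "key j < key k" if "j \<in> ?I" "k \<in> ?I" "\<tau> j < \<tau> k" for j k
    using key_total[of j k] \<tau>_less[of k j] that by force
  \<comment> \<open>A sorting bijection sends the point with the least key to \<open>Minf\<close>
    and the one with the greatest key to \<open>Pinf\<close>. This is applied to the endpoints,
    whose keys turn out to be extreme.\<close>
  have extreme: "\<tau> j = Minf" if "j \<in> ?I" "\<And>k. k \<in> ?I \<Longrightarrow> k \<noteq> j \<Longrightarrow> key j < key k" for j
  proof -
    obtain k where k: "k \<in> ?I" "\<tau> k = Minf"
      using \<tau> interval_simps(1) by (metis bij_betw_iff_bijections)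
    show ?thesis
      using that(2)[of k] \<tau>_less[of j k] k that(1) by (cases "k = j") auto
  qed
  have extreme': "\<tau> j = Pinf" if "j \<in> ?I" "\<And>k. k \<in> ?I \<Longrightarrow> k \<noteq> j \<Longrightarrow> key k < key j" for j
  proof -
    obtain k where k: "k \<in> ?I" "\<tau> k = Pinf"
      using \<tau> interval_simps(2) by (metis bij_betw_iff_bijections)
    show ?thesis
      using that(2)[of k] \<tau>_less[of k j] k that(1) by (cases "k = j") auto
  qed
  have below: "Minf < k" if "k \<noteq> Minf" for k :: "nat extended" using that by (cases k) auto
  have above: "k < Pinf" if "k \<noteq> Pinf" for k :: "nat extended" using that by (cases k) auto
  \<comment> \<open>Outside the fibre over \<open>Minf\<close> the first component decides, since
    \<pi>_x sends \<open>Minf\<close> to an extreme point. Inside that fibre the position decides,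
    with sign \<theta>.\<close>
  have key_Minf: "if snd x = 1 then key Minf < key k else key k < key Minf" if "k \<in> ?I" "k \<noteq> Minf" for k
  proof (cases "\<phi> k = Minf")
    case True
    with that key_fibre[of Minf k] below[of k] show ?thesis by (simp add: Hom_nabla_ends[OF \<phi>])
  next
    case False
    then have "weyl_perm x (\<phi> k) \<noteq> weyl_perm x Minf"
      using weyl_perm_inject[OF x] Hom_nabla_mem[OF \<phi>] that by auto
    with False that show ?thesis
      using snd_weyl_cases[OF x] key_less[of Minf k] key_less[of k Minf] weyl_perm_ends[of x]
        below[of "weyl_perm x (\<phi> k)"] above[of "weyl_perm x (\<phi> k)"]
      by (auto simp: Hom_nabla_ends[OF \<phi>])
  qed
  have key_Pinf: "if snd x = 1 then key k < key Pinf else key Pinf < key k" if "k \<in> ?I" "k \<noteq> Pinf" for k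
  proof (cases "\<phi> k = Pinf")
    case True
    with that key_fibre[of k Pinf] above[of k] show ?thesis by (simp add: Hom_nabla_ends[OF \<phi>])
  next
    case False
    then have "weyl_perm x (\<phi> k) \<noteq> weyl_perm x Pinf"
      using weyl_perm_inject[OF x] Hom_nabla_mem[OF \<phi>] that by auto
    with False that show ?thesis
      using snd_weyl_cases[OF x] key_less[of Pinf k] key_less[of k Pinf] weyl_perm_ends[of x]
        below[of "weyl_perm x (\<phi> k)"] above[of "weyl_perm x (\<phi> k)"]
      by (auto simp: Hom_nabla_ends[OF \<phi>])
  qed
  have ends: "snd x = 1 \<and> \<tau> Minf = Minf \<and> \<tau> Pinf = Pinf \<or> snd x = -1 \<and> \<tau> Minf = Pinf \<and> \<tau> Pinf = Minf"
    using snd_weyl_cases[OF x]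
  proof
    assume "snd x = -1"
    then show ?thesis using extreme[of Pinf] extreme'[of Minf] key_Minf key_Pinf by simp
  next
    assume "snd x = 1"
    then show ?thesis using extreme[of Minf] extreme'[of Pinf] key_Minf key_Pinf by simp
  qed
  have "weyl_sign x (\<phi> (Fin i)) = -1 \<or> weyl_sign x (\<phi> (Fin i)) = 1" if "i \<in> {1..m}" for i
    using sgn that by simp
  from weyl_perm_realize[OF \<tau> ends, of "\<lambda>i. weyl_sign x (\<phi> (Fin i))", OF this]
  obtain y where y: "y \<in> carrier (weyl_group m)" "snd y = snd x"
    "\<And>i. i \<in> ?I \<Longrightarrow> weyl_perm y i = \<tau> i"
    "\<And>i. i \<in> {1..m} \<Longrightarrow> weyl_sign y (Fin i) = weyl_sign x (\<phi> (Fin i))"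
    by blast
  \<comment> \<open>Transporting \<pi>_x \<phi> along the inverse of \<open>\<tau>\<close> gives a
    monotone map, because \<pi>_x \<phi> is the leading component of the key that
    \<open>\<tau>\<close> sorts.\<close>
  define \<phi>' where "\<phi>' = (\<lambda>j\<in>?I. weyl_perm x (\<phi> (inv_into ?I \<tau> j)))"
  have \<phi>'_\<tau>: "\<phi>' (\<tau> j) = weyl_perm x (\<phi> j)" if "j \<in> ?I" for j
    using that \<tau>_mem bij_betw_inv_into_left[OF \<tau> that] by (simp add: \<phi>'_def)
  have surj: "\<exists>k\<in>?I. j = \<tau> k" if "j \<in> ?I" for j
    using \<tau> that by (metis bij_betw_iff_bijections)
  have "\<phi>' \<in> Hom nabla m n"
    unfolding Hom_nabla_iff
  proof (intro conjI mono_onI PiE_I)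
    show "\<phi>' j \<in> interval n" if "j \<in> ?I" for j
      using surj[OF that] \<phi>'_\<tau> weyl_perm_mem[OF x] Hom_nabla_mem[OF \<phi>] by auto
    show "\<phi>' j = undefined" if "j \<notin> ?I" for j using that by (simp add: \<phi>'_def)
    show "\<phi>' j \<le> \<phi>' k" if "j \<in> ?I" "k \<in> ?I" "j \<le> k" for j k
    proof -
      obtain a b where ab: "a \<in> ?I" "b \<in> ?I" "j = \<tau> a" "k = \<tau> b" using surj \<open>j \<in> ?I\<close> \<open>k \<in> ?I\<close> by metis
      show ?thesis
      proof (cases "a = b")
        case False
        then have "\<tau> a < \<tau> b" using ab that(3) \<tau> by (auto simp: bij_betw_def inj_on_eq_iff less_le)
        then have "key a < key b" using key_le ab by blast
        then show ?thesis using ab \<phi>'_\<tau> by (auto simp: key_def)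
      qed (use ab in simp)
    qed
    show "\<phi>' Minf = Minf" "\<phi>' Pinf = Pinf"
      using ends \<phi>'_\<tau>[of Minf] \<phi>'_\<tau>[of Pinf] weyl_perm_ends[of x] by (auto simp: Hom_nabla_ends[OF \<phi>])
  qed
  moreover have "weyl_sign y j = weyl_sign x (\<phi> j)" if "j \<in> ?I" for j
    using that y by (cases rule: interval_cases) (auto simp: Hom_nabla_ends[OF \<phi>])
  moreover have "if weyl_sign x (\<phi> j) = 1 then \<tau> j < \<tau> k else \<tau> k < \<tau> j"
    if "j \<in> ?I" "k \<in> ?I" "j < k" "\<phi> j = \<phi> k" for j k
    using key_fibre[OF that] \<tau>_less[of j k] \<tau>_less[of k j] that by (simp split: if_splits)
  ultimately have "weyl_crossing m n \<phi> x \<phi>' y"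
    unfolding weyl_crossing_def using \<phi> x y(1,3) \<phi>'_\<tau> by simp
  then show thesis by (rule that)
qed

text \<open>Translates between the two descriptions: injectivity turns (anti)monotonicity on fibres
  into strict inequalities, and the commuting square together with injectivity of \<pi>_x yields the
  bijections between fibres.\<close>

lemma weyl_pull_eq:
  assumes cr: "weyl_crossing m n \<phi> x \<phi>' y"
  shows "weyl_pull m n \<phi> x = y"
  unfolding weyl_pull_def weyl_act_eq[OF cr]
proof (rule the_equality)
  let ?P = "\<lambda>y. y \<in> carrier (weyl_group m) \<and>
     (\<forall>j\<in>interval m. weyl_perm x (\<phi> j) = \<phi>' (weyl_perm y j)) \<and>
     (\<forall>i\<in>interval n.
        bij_betw (weyl_perm y) {j \<in> interval m. \<phi> j = i}
          {j \<in> interval m. \<phi>' j = weyl_perm x i} \<and>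
        (weyl_sign x i = 1 \<longrightarrow> mono_on {j \<in> interval m. \<phi> j = i} (weyl_perm y)) \<and>
        (weyl_sign x i = -1 \<longrightarrow> antimono_on {j \<in> interval m. \<phi> j = i} (weyl_perm y))) \<and>
     (\<forall>j\<in>{1..m}. weyl_sign y (Fin j) = weyl_sign x (\<phi> (Fin j))) \<and>
     snd y = snd x"
  note [simp] = Hom_nabla_ends[OF weyl_crossingD(1)[OF cr]]
  show "z = y" if "?P z" for z
  proof -
    have z: "z \<in> carrier (weyl_group m)" using that by blast
    have less: "if weyl_sign x (\<phi> j) = 1 then weyl_perm z j < weyl_perm z k
         else weyl_perm z k < weyl_perm z j"
      if jk: "j \<in> interval m" "k \<in> interval m" "j < k" "\<phi> j = \<phi> k" for j k
    proof -
      let ?F = "{l \<in> interval m. \<phi> l = \<phi> j}"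
      have "\<phi> j \<in> interval n" using Hom_nabla_mem[OF weyl_crossingD(1)[OF cr] jk(1)] .
      then have "weyl_sign x (\<phi> j) = 1 \<longrightarrow> mono_on ?F (weyl_perm z)"
        "weyl_sign x (\<phi> j) = -1 \<longrightarrow> antimono_on ?F (weyl_perm z)"
        "weyl_sign x (\<phi> j) = -1 \<or> weyl_sign x (\<phi> j) = 1"
        using \<open>?P z\<close> weyl_sign_cases[OF weyl_crossingD(2)[OF cr]] by blast+
      moreover have "weyl_perm z j \<noteq> weyl_perm z k" using weyl_perm_inject[OF z] jk by auto
      ultimately show ?thesis
        using jk by (auto simp: less_le monotone_on_def)
    qed
    have "weyl_sign z j = weyl_sign x (\<phi> j)" if "j \<in> interval m" for j
      using that \<open>?P z\<close> by (cases rule: interval_cases) auto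
    then have "weyl_crossing m n \<phi> x \<phi>' z"
      unfolding weyl_crossing_def using \<open>?P z\<close> less weyl_crossingD(1-3)[OF cr] by auto
    then show ?thesis using weyl_crossing_unique(2)[OF cr] by blast
  qed
  have bij: "bij_betw (weyl_perm y) {j \<in> interval m. \<phi> j = i} {j \<in> interval m. \<phi>' j = weyl_perm x i}"
    if i: "i \<in> interval n" for i
  proof (rule bij_betw_imageI)
    have bij: "bij_betw (weyl_perm y) (interval m) (interval m)"
      by (rule weyl_perm_bij[OF weyl_crossingD(4)[OF cr]])
    then show "inj_on (weyl_perm y) {j \<in> interval m. \<phi> j = i}"
      by (auto simp: bij_betw_def intro: inj_on_subset)
    have "\<phi>' (weyl_perm y j) = weyl_perm x i \<longleftrightarrow> \<phi> j = i" if "j \<in> interval m" for j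
      using weyl_crossingD(5)[OF cr that] weyl_perm_inject[OF weyl_crossingD(2)[OF cr] _ i]
        Hom_nabla_mem[OF weyl_crossingD(1)[OF cr] that] by metis
    moreover have "weyl_perm y ` interval m = interval m"
      using bij by (simp add: bij_betw_def)
    ultimately show "weyl_perm y ` {j \<in> interval m. \<phi> j = i} = {j \<in> interval m. \<phi>' j = weyl_perm x i}"
      by (fastforce simp: image_iff)
  qed
  have "mono_on {j \<in> interval m. \<phi> j = i} (weyl_perm y)" if "weyl_sign x i = 1" for i
    using weyl_crossingD(7)[OF cr] that by (auto simp: monotone_on_def le_less)
  moreover have "antimono_on {j \<in> interval m. \<phi> j = i} (weyl_perm y)" if "weyl_sign x i = -1" for i
    using weyl_crossingD(8)[OF cr] that by (auto simp: monotone_on_def le_less)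
  ultimately show "?P y"
    using bij weyl_crossingD(4-6)[OF cr] weyl_crossing_snd[OF cr] by auto
qed

lemma weyl_crossing_weyl:
  assumes "\<phi> \<in> Hom nabla m n" "x \<in> carrier (weyl_group n)"
  shows "weyl_crossing m n \<phi> x (weyl_act m n x \<phi>) (weyl_pull m n \<phi> x)"
proof -
  obtain \<phi>' y where "weyl_crossing m n \<phi> x \<phi>' y"
    using weyl_crossing_exists[OF assms] .
  then show ?thesis using weyl_act_eq weyl_pull_eq by simp
qed

section \<open>Units and composites of crossings\<close>

lemma weyl_crossing_one:
  "\<phi> \<in> Hom nabla m n \<Longrightarrow> weyl_crossing m n \<phi> \<one>\<^bsub>weyl_group n\<^esub> \<phi> \<one>\<^bsub>weyl_group m\<^esub>"
  by (auto simp: weyl_crossing_def Hom_nabla_mem monoid.one_closed[OF group.is_monoid[OF group_weyl_group]])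

lemma weyl_crossing_ident:
  "x \<in> carrier (weyl_group n) \<Longrightarrow>
    weyl_crossing n n (restrict id (interval n)) x (restrict id (interval n)) x"
  by (auto simp: weyl_crossing_def weyl_perm_mem)

text \<open>The permutation of \<open>y'\<close> carries a fibre of \<open>\<phi>\<close> into one
  of \<open>\<phi>'\<close>, and that of \<open>x'\<close> carries it on. Each sign -1 reverses the
  order once, so the net effect is the product of the signs, which is the sign of the
  product.\<close>

lemma weyl_crossing_mult:
  assumes y: "weyl_crossing m n \<phi> y \<phi>' y'" and x: "weyl_crossing m n \<phi>' x \<phi>'' x'"
  shows "weyl_crossing m n \<phi> (x \<otimes>\<^bsub>weyl_group n\<^esub> y) \<phi>'' (x' \<otimes>\<^bsub>weyl_group m\<^esub> y')"
proof -
  note D = weyl_crossingD[OF y] and E = weyl_crossingD[OF x]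
  have mem: "weyl_perm y' j \<in> interval m" "\<phi> j \<in> interval n" if "j \<in> interval m" for j
    using that weyl_perm_mem D(4) Hom_nabla_mem[OF D(1)] by auto
  have less: "if weyl_sign x (weyl_perm y (\<phi> j)) * weyl_sign y (\<phi> j) = 1
      then weyl_perm x' (weyl_perm y' j) < weyl_perm x' (weyl_perm y' k)
      else weyl_perm x' (weyl_perm y' k) < weyl_perm x' (weyl_perm y' j)"
    if jk: "j \<in> interval m" "k \<in> interval m" "j < k" "\<phi> j = \<phi> k" for j k
  proof -
    have eq: "\<phi>' (weyl_perm y' j) = \<phi>' (weyl_perm y' k)" "\<phi>' (weyl_perm y' k) = weyl_perm y (\<phi> k)"
      using D(5)[of j] D(5)[of k] jk by auto
    have "weyl_sign y (\<phi> j) = -1 \<or> weyl_sign y (\<phi> j) = 1"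
      using weyl_sign_cases D(2) mem jk by blast
    moreover have "weyl_sign x (weyl_perm y (\<phi> j)) = -1 \<or> weyl_sign x (weyl_perm y (\<phi> j)) = 1"
      using weyl_sign_cases E(2) weyl_perm_mem[OF D(2)] mem jk by blast
    ultimately show ?thesis
      using D(7,8)[OF jk] E(7,8)[of "weyl_perm y' j" "weyl_perm y' k"]
        E(7,8)[of "weyl_perm y' k" "weyl_perm y' j"] mem jk eq by auto
  qed
  show ?thesis
    unfolding weyl_crossing_def
    using D(1) E(3) mem less weyl_mult_carrier[OF E(2) D(2)] weyl_mult_carrier[OF E(4) D(4)]
    by (simp add: weyl_perm_mult[OF E(2) D(2)] weyl_perm_mult[OF E(4) D(4)] weyl_sign_mult
        D(5,6) E(5,6))
qed

text \<open>Take two points in one fibre of the composite. If \<open>\<phi>\<close> identifies them,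
  the sign of \<open>y\<close>, inherited from \<open>x\<close>, orders their images. Otherwise the
  monotone \<open>\<phi>\<close> keeps their order, the sign of \<open>x\<close> decides what
  \<open>y\<close> does to it, and \<open>weyl_crossing_less\<close> passes the result to
  \<open>z\<close>.\<close>

lemma weyl_crossing_comp:
  assumes \<psi>: "weyl_crossing m n \<psi> x \<psi>' y" and \<phi>: "weyl_crossing l m \<phi> y \<phi>' z"
  shows "weyl_crossing l n (compose (interval l) \<psi> \<phi>) x (compose (interval l) \<psi>' \<phi>') z"
proof -
  note D = weyl_crossingD[OF \<psi>] and E = weyl_crossingD[OF \<phi>]
  have mem: "\<phi> j \<in> interval m" "weyl_perm z j \<in> interval l" if "j \<in> interval l" for j
    using that weyl_perm_mem E(4) Hom_nabla_mem[OF E(1)] by auto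
  have less: "if weyl_sign x (\<psi> (\<phi> j)) = 1 then weyl_perm z j < weyl_perm z k
      else weyl_perm z k < weyl_perm z j"
    if jk: "j \<in> interval l" "k \<in> interval l" "j < k" "\<psi> (\<phi> j) = \<psi> (\<phi> k)" for j k
  proof (cases "\<phi> j = \<phi> k")
    case True
    have "weyl_sign y (\<phi> j) = weyl_sign x (\<psi> (\<phi> j))" using D(6) mem jk by blast
    moreover have "weyl_sign y (\<phi> j) = -1 \<or> weyl_sign y (\<phi> j) = 1"
      using weyl_sign_cases E(2) mem jk by blast
    ultimately show ?thesis using E(7,8)[OF jk(1-3) True] by auto
  next
    case False
    then have "\<phi> j < \<phi> k" using Hom_nabla_mono[OF E(1)] jk by (simp add: less_le)
    moreover have "weyl_sign x (\<psi> (\<phi> j)) = -1 \<or> weyl_sign x (\<psi> (\<phi> j)) = 1"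
      using weyl_sign_cases D(2) Hom_nabla_mem[OF D(1)] mem jk by blast
    ultimately show ?thesis
      using D(7,8)[of "\<phi> j" "\<phi> k"] weyl_crossing_less[OF \<phi>, of j k] weyl_crossing_less[OF \<phi>, of k j]
        jk mem by auto
  qed
  have "weyl_perm x (\<psi> (\<phi> j)) = \<psi>' (\<phi>' (weyl_perm z j))" "weyl_sign z j = weyl_sign x (\<psi> (\<phi> j))"
    if "j \<in> interval l" for j
    using D(5,6)[of "\<phi> j"] E(5,6)[OF that] mem[OF that] by simp_all
  then show ?thesis
    unfolding weyl_crossing_def
    using D(2) E(4) mem less compose_nabla_Hom[OF E(1) D(1)] compose_nabla_Hom[OF E(3) D(3)]
    by (simp add: compose_eq)
qed

section \<open>The crossed group axioms\<close>

lemma weyl_sel [simp]: "Grp weyl = weyl_group" "Pull weyl = weyl_pull" "Act weyl = weyl_act"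
  by (simp_all add: weyl_def)

theorem crossed_group_weyl: "crossed_group nabla weyl"
proof (rule crossed_group.intro[OF small_category_nabla crossed_group_axioms.intro],
  unfold weyl_sel nabla_sel)
  fix a b c :: nat and \<phi> \<psi> :: "nat extended \<Rightarrow> nat extended" and x y
  show "group (weyl_group a)" by (rule group_weyl_group)
  show "weyl_pull a a (restrict id (interval a)) x = x" if "x \<in> carrier (weyl_group a)"
    using weyl_pull_eq[OF weyl_crossing_ident[OF that]] .
  assume \<phi>: "\<phi> \<in> Hom nabla a b"
  show "weyl_act a b \<one>\<^bsub>weyl_group b\<^esub> \<phi> = \<phi>"
    using weyl_act_eq[OF weyl_crossing_one[OF \<phi>]] .
  show "weyl_pull a b \<phi> x \<in> carrier (weyl_group a)" "weyl_act a b x \<phi> \<in> Hom nabla a b"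
    if "x \<in> carrier (weyl_group b)"
    using weyl_crossingD(3,4)[OF weyl_crossing_weyl[OF \<phi> that]] by auto
  show "weyl_act a b (x \<otimes>\<^bsub>weyl_group b\<^esub> y) \<phi> = weyl_act a b x (weyl_act a b y \<phi>)"
    "weyl_pull a b \<phi> (x \<otimes>\<^bsub>weyl_group b\<^esub> y) =
      weyl_pull a b (weyl_act a b y \<phi>) x \<otimes>\<^bsub>weyl_group a\<^esub> weyl_pull a b \<phi> y"
    if x: "x \<in> carrier (weyl_group b)" and y: "y \<in> carrier (weyl_group b)"
  proof -
    note c = weyl_crossing_weyl[OF \<phi> y]
    \<comment> \<open>The second crossing starts at \<open>weyl_act a b y \<phi>\<close>, which is
      why \<open>x\<close> is pulled back along \<phi>^y and not along \<phi>.\<close>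
    note d = weyl_crossing_mult[OF c weyl_crossing_weyl[OF weyl_crossingD(3)[OF c] x]]
    show "weyl_act a b (x \<otimes>\<^bsub>weyl_group b\<^esub> y) \<phi> = weyl_act a b x (weyl_act a b y \<phi>)"
      using weyl_act_eq[OF d] .
    show "weyl_pull a b \<phi> (x \<otimes>\<^bsub>weyl_group b\<^esub> y) =
        weyl_pull a b (weyl_act a b y \<phi>) x \<otimes>\<^bsub>weyl_group a\<^esub> weyl_pull a b \<phi> y"
      using weyl_pull_eq[OF d] .
  qed
  show "weyl_pull a c (compose (interval a) \<psi> \<phi>) x = weyl_pull a b \<phi> (weyl_pull b c \<psi> x)"
    "weyl_act a c x (compose (interval a) \<psi> \<phi>) =
      compose (interval a) (weyl_act b c x \<psi>) (weyl_act a b (weyl_pull b c \<psi> x) \<phi>)"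
    if \<psi>: "\<psi> \<in> Hom nabla b c" and x: "x \<in> carrier (weyl_group c)"
  proof -
    note c = weyl_crossing_weyl[OF \<psi> x]
    note d = weyl_crossing_comp[OF c weyl_crossing_weyl[OF \<phi> weyl_crossingD(4)[OF c]]]
    show "weyl_pull a c (compose (interval a) \<psi> \<phi>) x = weyl_pull a b \<phi> (weyl_pull b c \<psi> x)"
      using weyl_pull_eq[OF d] .
    show "weyl_act a c x (compose (interval a) \<psi> \<phi>) =
        compose (interval a) (weyl_act b c x \<psi>) (weyl_act a b (weyl_pull b c \<psi> x) \<phi>)"
      using weyl_act_eq[OF d] .
  qed
qed

section \<open>The six crossed subgroups\<close>

text \<open>Replaces the definite description in \<open>weyl_pull\<close> by the crossing relation,
  so that closure can be tested on any explicitly given crossing.\<close>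

lemma crossed_subgroup_weyl_iff:
  "crossed_subgroup nabla weyl K \<longleftrightarrow>
    (\<forall>n. subgroup (K n) (weyl_group n)) \<and>
    (\<forall>m n \<phi> x \<phi>' y. weyl_crossing m n \<phi> x \<phi>' y \<longrightarrow> x \<in> K n \<longrightarrow> y \<in> K m)"
    (is "_ \<longleftrightarrow> ?sub \<and> ?cross")
proof
  assume "crossed_subgroup nabla weyl K"
  then interpret crossed_subgroup nabla weyl K .
  have "y \<in> K m" if "weyl_crossing m n \<phi> x \<phi>' y" "x \<in> K n" for m n \<phi> x \<phi>' y
    using sub_pull_closed[of m n \<phi> x] weyl_pull_eq[OF that(1)] weyl_crossingD(1)[OF that(1)] that(2)
    by simp
  then show "?sub \<and> ?cross" using subgroup by auto
next
  assume *: "?sub \<and> ?cross"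
  have "weyl_pull m n \<phi> x \<in> K m" if "\<phi> \<in> Hom nabla m n" "x \<in> K n" for m n \<phi> x
  proof -
    have "x \<in> carrier (weyl_group n)" using * that(2) subgroup.subset by blast
    then show ?thesis using weyl_crossing_weyl[OF that(1)] * that(2) by blast
  qed
  with * show "crossed_subgroup nabla weyl K"
    by (intro crossed_subgroup.intro[OF crossed_group_weyl] crossed_subgroup_axioms.intro) simp_all
qed

lemma weyl_sign_inv:
  assumes "x \<in> carrier (weyl_group n)" "i \<in> interval n"
  shows "weyl_sign (inv\<^bsub>weyl_group n\<^esub> x) i = weyl_sign x (weyl_perm (inv\<^bsub>weyl_group n\<^esub> x) i)"
  using assms by (cases x rule: weyl_elt_cases) (auto simp: weyl_inv elim!: interval_cases)

lemma weyl_subgroupI: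
  assumes "H \<subseteq> carrier (weyl_group n)" "\<one>\<^bsub>weyl_group n\<^esub> \<in> H"
    and "\<And>x. x \<in> H \<Longrightarrow> inv\<^bsub>weyl_group n\<^esub> x \<in> H"
    and "\<And>x y. x \<in> H \<Longrightarrow> y \<in> H \<Longrightarrow> x \<otimes>\<^bsub>weyl_group n\<^esub> y \<in> H"
  shows "subgroup H (weyl_group n)"
  using assms by (intro group.subgroupI[OF group_weyl_group]) auto

lemma weyl_one_carrier [simp]: "\<one>\<^bsub>weyl_group n\<^esub> \<in> carrier (weyl_group n)"
  by (rule monoid.one_closed[OF group.is_monoid[OF group_weyl_group]])

lemma snd_weyl_one [simp]: "snd \<one>\<^bsub>weyl_group n\<^esub> = 1"
  by (simp add: weyl_one)

lemma weyl_inv_carrier: "x \<in> carrier (weyl_group n) \<Longrightarrow> inv\<^bsub>weyl_group n\<^esub> x \<in> carrier (weyl_group n)"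
  by (rule group.inv_closed[OF group_weyl_group])

section \<open>Families described by signs\<close>

lemma restrict_const_iff:
  "\<epsilon> \<in> {1..n} \<rightarrow>\<^sub>E S \<Longrightarrow> \<epsilon> = (\<lambda>i\<in>{1..n}. c) \<longleftrightarrow> (\<forall>i\<in>{1..n}. \<epsilon> i = c)"
  by (auto simp: fun_eq_iff PiE_def extensional_def restrict_def)

lemma symmetric_family_iff:
  "x \<in> symmetric_family n \<longleftrightarrow> x \<in> carrier (weyl_group n) \<and> (\<forall>i\<in>interval n. weyl_sign x i = 1)"
proof (cases x rule: weyl_elt_cases)
  case (1 \<sigma> \<epsilon> \<theta>)
  show ?thesis
    using restrict_const_iff[of \<epsilon> n "{-1, 1}" 1]
    by (auto simp: 1 symmetric_family_def sym_group_carrier weyl_carrier_iff interval_def)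
qed

lemma reflexosymmetric_family_iff:
  "x \<in> reflexosymmetric_family n \<longleftrightarrow>
    x \<in> carrier (weyl_group n) \<and> (\<forall>i\<in>interval n. weyl_sign x i = snd x)"
proof (cases x rule: weyl_elt_cases)
  case (1 \<sigma> \<epsilon> \<theta>)
  show ?thesis
    using restrict_const_iff[of \<epsilon> n "{-1, 1}" \<theta>]
    by (auto simp: 1 reflexosymmetric_family_def sym_group_carrier sign_img_def weyl_carrier_iff interval_def)
qed

lemma hyperoctahedral_family_iff:
  "x \<in> hyperoctahedral_family n \<longleftrightarrow> x \<in> carrier (weyl_group n) \<and> snd x = 1"
  by (cases x rule: weyl_elt_cases)
    (auto simp: hyperoctahedral_family_def sym_group_carrier sign_img_def weyl_carrier_iff)

lemma reflexosymmetric_signs_inv: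
  assumes x: "x \<in> carrier (weyl_group n)" "\<forall>i\<in>interval n. weyl_sign x i = snd x"
    and i: "i \<in> interval n"
  shows "weyl_sign (inv\<^bsub>weyl_group n\<^esub> x) i = snd x"
  using weyl_sign_inv[OF x(1) i] x(2) weyl_perm_mem[OF weyl_inv_carrier[OF x(1)] i] by simp

text \<open>Every sign of a pullback is a sign of \<open>x\<close>, so a constant sign stays
  constant; it still equals \<theta>, which pullbacks preserve.\<close>

lemma crossed_subgroup_reflexosymmetric: "crossed_subgroup nabla weyl reflexosymmetric_family"
  unfolding crossed_subgroup_weyl_iff
proof (intro conjI allI impI)
  show "subgroup (reflexosymmetric_family n) (weyl_group n)" for n
  proof (rule weyl_subgroupI)
    show "inv\<^bsub>weyl_group n\<^esub> x \<in> reflexosymmetric_family n" if "x \<in> reflexosymmetric_family n" for x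
      using that reflexosymmetric_signs_inv[of x n] reflexosymmetric_signs_inv[of x n Minf] weyl_inv_carrier
      unfolding reflexosymmetric_family_iff by simp
  qed (auto simp: reflexosymmetric_family_iff weyl_mult_carrier weyl_sign_mult weyl_perm_mem)
  show "y \<in> reflexosymmetric_family m"
    if cr: "weyl_crossing m n \<phi> x \<phi>' y" and x: "x \<in> reflexosymmetric_family n" for m n \<phi> x \<phi>' y
    using x weyl_crossingD(4,6)[OF cr] weyl_crossing_snd[OF cr] Hom_nabla_mem[OF weyl_crossingD(1)[OF cr]]
    by (simp add: reflexosymmetric_family_iff)
qed

lemma crossed_subgroup_hyperoctahedral: "crossed_subgroup nabla weyl hyperoctahedral_family"
  unfolding crossed_subgroup_weyl_iff
proof (intro conjI allI impI)
  show "subgroup (hyperoctahedral_family n) (weyl_group n)" for n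
  proof (rule weyl_subgroupI)
    show "inv\<^bsub>weyl_group n\<^esub> x \<in> hyperoctahedral_family n" if "x \<in> hyperoctahedral_family n" for x
      using that weyl_sign_inv[of x n Minf] weyl_inv_carrier weyl_perm_mem
      by (cases x rule: weyl_elt_cases) (auto simp: hyperoctahedral_family_iff weyl_inv)
  qed (auto simp: hyperoctahedral_family_iff weyl_mult_carrier)
  show "y \<in> hyperoctahedral_family m"
    if cr: "weyl_crossing m n \<phi> x \<phi>' y" and x: "x \<in> hyperoctahedral_family n" for m n \<phi> x \<phi>' y
    using x weyl_crossingD(4)[OF cr] weyl_crossing_snd[OF cr] by (simp add: hyperoctahedral_family_iff)
qed

lemma crossed_subgroup_weyl_family: "crossed_subgroup nabla weyl weyl_family"
  unfolding crossed_subgroup_weyl_iff weyl_family_def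
  using group.subgroup_self[OF group_weyl_group] weyl_crossingD(4) by blast

text \<open>Serves to cut the reflexosymmetric and reflexive families down to \<theta> = 1, giving
  the symmetric and trivial ones.\<close>

lemma crossed_subgroup_Int:
  assumes "crossed_subgroup nabla weyl K" "crossed_subgroup nabla weyl L"
  shows "crossed_subgroup nabla weyl (\<lambda>n. K n \<inter> L n)"
  using assms unfolding crossed_subgroup_weyl_iff
  by (auto intro!: group.subgroups_Inter_pair[OF group_weyl_group])

lemma symmetric_family_eq: "symmetric_family n = reflexosymmetric_family n \<inter> hyperoctahedral_family n"
  using bspec[of "interval n" "\<lambda>i. weyl_sign _ i = 1" Minf]
  by (auto simp: symmetric_family_iff reflexosymmetric_family_iff hyperoctahedral_family_iff
      simp del: split_paired_All)

lemma crossed_subgroup_symmetric: "crossed_subgroup nabla weyl symmetric_family"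
  using crossed_subgroup_Int[OF crossed_subgroup_reflexosymmetric crossed_subgroup_hyperoctahedral]
  unfolding symmetric_family_eq[symmetric] .

lemma trivial_family_iff: "x \<in> trivial_family n \<longleftrightarrow> x = \<one>\<^bsub>weyl_group n\<^esub>"
  by (simp add: trivial_family_def)

text \<open>Its permutation is the order-reversing bijection of the whole interval, endpoints
  included.\<close>

abbreviation weyl_reversal :: "nat \<Rightarrow> weyl_elt" where
  "weyl_reversal n \<equiv> ((reversal n, \<lambda>i\<in>{1..n}. -1), -1)"

lemma reversal_permutes: "reversal n permutes {1..n}"
proof (rule bij_imp_permutes)
  show "bij_betw (reversal n) {1..n} {1..n}"
    by (rule bij_betw_byWitness[of _ "reversal n"]) (auto simp: reversal_def)
qed (auto simp: reversal_def)

lemma weyl_reversal_carrier [simp]: "weyl_reversal n \<in> carrier (weyl_group n)"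
  by (simp add: weyl_carrier_iff reversal_permutes)

lemma weyl_reversal_sign: "i \<in> interval n \<Longrightarrow> weyl_sign (weyl_reversal n) i = -1"
  by (auto elim!: interval_cases)

lemma weyl_reversal_perm:
  assumes "i \<in> interval n"
  shows "weyl_perm (weyl_reversal n) (weyl_perm (weyl_reversal n) i) = i"
    and "j \<in> interval n \<Longrightarrow> i < j \<Longrightarrow> weyl_perm (weyl_reversal n) j < weyl_perm (weyl_reversal n) i"
  using assms by (auto simp: reversal_def elim!: interval_cases)

lemma weyl_reversal_mult: "weyl_reversal n \<otimes>\<^bsub>weyl_group n\<^esub> weyl_reversal n = \<one>\<^bsub>weyl_group n\<^esub>"
  by (rule weyl_eqI[of _ n])
    (auto simp: weyl_mult_carrier weyl_perm_mult weyl_sign_mult weyl_reversal_perm weyl_reversal_sign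
      weyl_perm_mem simp del: weyl_perm.simps weyl_sign.simps)

text \<open>Conjugating \<open>\<phi>\<close> by reversals restores monotonicity, and a reversal
  inverts the order on every fibre, as signs that are all -1 demand. So reversals pull back to
  reversals.\<close>

lemma weyl_crossing_reversal:
  assumes \<phi>: "\<phi> \<in> Hom nabla m n"
  shows "weyl_crossing m n \<phi> (weyl_reversal n)
    (\<lambda>j\<in>interval m. weyl_perm (weyl_reversal n) (\<phi> (weyl_perm (weyl_reversal m) j))) (weyl_reversal m)"
proof -
  let ?r = "\<lambda>n. weyl_perm (weyl_reversal n)"
  have mem: "?r k i \<in> interval k" if "i \<in> interval k" for k i
    by (rule weyl_perm_mem[OF weyl_reversal_carrier that])
  have anti: "?r k j \<le> ?r k i" if "i \<in> interval k" "j \<in> interval k" "i \<le> j" for k i j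
    using weyl_reversal_perm(2)[of i k j] that by (cases "i = j")
      (auto simp: order.strict_iff_order simp del: weyl_perm.simps)
  \<comment> \<open>Only the endpoint equations of \<open>weyl_perm\<close> are unfolded; on general
    points monotonicity comes from using \<open>anti\<close> twice.\<close>
  have "(\<lambda>j\<in>interval m. ?r n (\<phi> (?r m j))) \<in> Hom nabla m n"
    unfolding Hom_nabla_iff
    by (intro conjI mono_onI)
      (auto simp: mem Hom_nabla_mem[OF \<phi>] Hom_nabla_ends[OF \<phi>] anti Hom_nabla_mono[OF \<phi>]
        simp del: weyl_perm.simps(1))
  then show ?thesis
    unfolding weyl_crossing_def
    using \<phi> weyl_reversal_perm weyl_reversal_sign mem Hom_nabla_mem[OF \<phi>]
    by (auto simp del: weyl_perm.simps weyl_sign.simps)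
qed

lemma reflexive_family_iff:
  "x \<in> reflexive_family n \<longleftrightarrow> x = \<one>\<^bsub>weyl_group n\<^esub> \<or> x = weyl_reversal n"
  by (simp add: reflexive_family_def)

lemma crossed_subgroup_reflexive: "crossed_subgroup nabla weyl reflexive_family"
  unfolding crossed_subgroup_weyl_iff
proof (intro conjI allI impI)
  show "subgroup (reflexive_family n) (weyl_group n)" for n
  proof -
    interpret group "weyl_group n" by (rule group_weyl_group)
    show ?thesis
      using inv_equality[OF weyl_reversal_mult]
      by (intro weyl_subgroupI) (auto simp: reflexive_family_iff weyl_reversal_mult)
  qed
  \<comment> \<open>The crossings of \<phi> with the unit and with the reversal are known
    explicitly, so uniqueness identifies \<open>y\<close>.\<close>
  show "y \<in> reflexive_family m"
    if cr: "weyl_crossing m n \<phi> x \<phi>' y" and x: "x \<in> reflexive_family n" for m n \<phi> x \<phi>' y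
    using x weyl_crossing_unique(2)[OF cr] weyl_crossing_one[OF weyl_crossingD(1)[OF cr]]
      weyl_crossing_reversal[OF weyl_crossingD(1)[OF cr]]
    unfolding reflexive_family_iff by blast
qed

lemma trivial_family_eq: "trivial_family n = reflexive_family n \<inter> hyperoctahedral_family n"
  by (auto simp: trivial_family_iff reflexive_family_iff hyperoctahedral_family_iff weyl_one
      weyl_carrier_iff permutes_id)

lemma crossed_subgroup_trivial: "crossed_subgroup nabla weyl trivial_family"
  using crossed_subgroup_Int[OF crossed_subgroup_reflexive crossed_subgroup_hyperoctahedral]
  unfolding trivial_family_eq[symmetric] .

section \<open>The classification\<close>

text \<open>Pulling back along this map spreads an element of degree \<open>p\<close> over the
  window \<open>k\<close>, ..., \<open>k + p - 1\<close> of degree \<open>m\<close>. It is used for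
  \<open>p\<close> equal to 0, 1 and 2.\<close>

definition interval_collapse :: "nat \<Rightarrow> nat \<Rightarrow> nat \<Rightarrow> nat extended \<Rightarrow> nat extended" where
  "interval_collapse m k p = (\<lambda>j\<in>interval m. case j of
     Fin i \<Rightarrow> if i < k then Minf else if i < k + p then Fin (i - k + 1) else Pinf | _ \<Rightarrow> j)"

text \<open>Pulling back along this map restricts an element to the points \<open>f 1\<close>, ...,
  \<open>f p\<close>. A point may be repeated, which doubles it.\<close>

definition interval_embed :: "nat \<Rightarrow> (nat \<Rightarrow> nat) \<Rightarrow> nat extended \<Rightarrow> nat extended" where
  "interval_embed p f = (\<lambda>j\<in>interval p. case j of Fin i \<Rightarrow> Fin (f i) | _ \<Rightarrow> j)"

lemma interval_collapse_Hom: "interval_collapse m k p \<in> Hom nabla m p"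
  unfolding Hom_nabla_iff
  by (intro conjI mono_onI) (auto simp: interval_collapse_def elim!: interval_cases)

lemma interval_embed_Hom:
  assumes "\<And>i. i \<in> {1..p} \<Longrightarrow> f i \<in> {1..n}"
    and "\<And>i j. i \<in> {1..p} \<Longrightarrow> j \<in> {1..p} \<Longrightarrow> i \<le> j \<Longrightarrow> f i \<le> f j"
  shows "interval_embed p f \<in> Hom nabla p n"
  unfolding Hom_nabla_iff
  by (intro conjI mono_onI) (use assms in \<open>auto simp: interval_embed_def elim!: interval_cases\<close>)

lemma interval_collapse_simps:
  "interval_collapse m k p Minf = Minf" "interval_collapse m k p Pinf = Pinf"
  "i \<in> {1..m} \<Longrightarrow> interval_collapse m k p (Fin i) =
    (if i < k then Minf else if i < k + p then Fin (i - k + 1) else Pinf)"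
  by (auto simp: interval_collapse_def)

text \<open>Here \<open>x\<close> moves no point, so the morphism is its own transform. The fibre
  over \<open>Fin 1\<close> has at most the one point \<open>k\<close>, hence nothing is permuted
  and only the sign at \<open>k\<close> changes. For \<open>k\<close> outside \<open>{1..m}\<close>
  the result is the unit.\<close>

lemma weyl_crossing_flip:
  assumes x: "x \<in> carrier (weyl_group 1)" "snd x = 1" "weyl_sign x (Fin 1) = -1"
  shows "weyl_crossing m 1 (interval_collapse m k 1) x (interval_collapse m k 1)
    ((id, \<lambda>i\<in>{1..m}. if i = k then -1 else 1), 1)"
proof -
  obtain \<sigma> \<epsilon> where x_eq: "x = ((\<sigma>, \<epsilon>), 1)" using x(2) by (cases x rule: weyl_elt_cases) auto
  have "\<sigma> permutes {1..1}" using x by (simp add: x_eq weyl_carrier_iff)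
  then have [simp]: "\<sigma> = id" by simp
  have [simp]: "\<epsilon> 1 = -1" using x by (simp add: x_eq)
  show ?thesis
    unfolding weyl_crossing_def
    using x by (auto simp: x_eq interval_collapse_Hom weyl_carrier_iff permutes_id
        interval_collapse_simps elim!: interval_cases split: if_splits)
qed

text \<open>The inversion makes \<open>x\<close> the transposition in degree 2. The interior fibres
  are the single points \<open>k\<close> and \<open>Suc k\<close>, which get exchanged; the fibres
  over the endpoints have sign 1 and stay put.\<close>

lemma weyl_crossing_adjacent:
  assumes x: "x \<in> carrier (weyl_group 2)" "snd x = 1" "\<And>i. i \<in> interval 2 \<Longrightarrow> weyl_sign x i = 1"
    and inversion: "weyl_perm x (Fin 2) < weyl_perm x (Fin 1)"
    and k: "k \<in> {1..m}" "Suc k \<in> {1..m}"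
  shows "weyl_crossing m 2 (interval_collapse m k 2) x (interval_collapse m k 2)
    ((transpose k (Suc k), \<lambda>i\<in>{1..m}. 1), 1)"
proof -
  obtain \<sigma> \<epsilon> where x_eq: "x = ((\<sigma>, \<epsilon>), 1)" using x(2) by (cases x rule: weyl_elt_cases) auto
  have "\<sigma> permutes {1..2}" using x by (simp add: x_eq weyl_carrier_iff)
  then have "\<sigma> 1 \<in> {1..2}" "\<sigma> 2 \<in> {1..2}" using permutes_in_image by fastforce+
  then have [simp]: "\<sigma> 1 = 2" "\<sigma> 2 = 1" using inversion by (auto simp: x_eq)
  have x_perm: "weyl_perm ((\<sigma>, \<epsilon>), 1) (Fin 1) = Fin 2" "weyl_perm ((\<sigma>, \<epsilon>), 1) (Fin 2) = Fin 1"
    by simp_all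
  have [simp]: "\<epsilon> 1 = 1" "\<epsilon> 2 = 1" using x(3)[of "Fin 1"] x(3)[of "Fin 2"] by (auto simp: x_eq)
  have perm: "weyl_perm ((transpose k (Suc k), \<lambda>i\<in>{1..m}. 1), 1) (Fin i) =
      (if i = k then Fin (Suc k) else if i = Suc k then Fin k else Fin i)" for i
    by (auto simp: transpose_def)
  have cases: "interval_collapse m k 2 (Fin i) = (if i < k then Minf else if i = k then Fin 1
      else if i = Suc k then Fin 2 else Pinf)" if "i \<in> {1..m}" for i
    using that by (auto simp: interval_collapse_simps)
  show ?thesis
    unfolding weyl_crossing_def
    using x k permutes_swap_id[OF k]
    by (auto simp: x_eq interval_collapse_Hom weyl_carrier_iff interval_collapse_simps(1,2) cases perm x_perm
        simp del: weyl_perm.simps(1) elim!: interval_cases split: if_splits)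
qed

section \<open>Elements forced into an arbitrary crossed subgroup\<close>

context
  fixes K
  assumes K: "crossed_subgroup nabla weyl K"
begin

lemma weyl_sub_crossing: "weyl_crossing m n \<phi> x \<phi>' y \<Longrightarrow> x \<in> K n \<Longrightarrow> y \<in> K m"
  using K unfolding crossed_subgroup_weyl_iff by blast

lemma weyl_sub_subgroup: "subgroup (K n) (weyl_group n)"
  using K unfolding crossed_subgroup_weyl_iff by blast

lemma weyl_sub_carrier: "x \<in> K n \<Longrightarrow> x \<in> carrier (weyl_group n)"
  by (rule subgroup.mem_carrier[OF weyl_sub_subgroup])

lemma weyl_sub_mult: "x \<in> K n \<Longrightarrow> y \<in> K n \<Longrightarrow> x \<otimes>\<^bsub>weyl_group n\<^esub> y \<in> K n"
  by (rule subgroup.m_closed[OF weyl_sub_subgroup])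

lemma weyl_sub_one: "\<one>\<^bsub>weyl_group n\<^esub> \<in> K n"
  by (rule subgroup.one_closed[OF weyl_sub_subgroup])

lemma weyl_sub_pull:
  assumes "x \<in> K n" "\<phi> \<in> Hom nabla m n"
  obtains \<phi>' y where "y \<in> K m" "weyl_crossing m n \<phi> x \<phi>' y"
  using that weyl_sub_crossing[OF _ assms(1)] weyl_crossing_weyl[OF assms(2) weyl_sub_carrier[OF assms(1)]]
  by metis

text \<open>Restriction to degree 0 keeps \<theta> = -1, and in degree 0 the only such element is
  the reversal; reversals then pull back to every degree.\<close>

lemma weyl_sub_reversal:
  assumes "x \<in> K n" "snd x = -1"
  shows "weyl_reversal m \<in> K m"
proof -
  \<comment> \<open>Degree 0 has no interior point, so \<open>id\<close> is only a
    placeholder.\<close>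
  have "interval_embed 0 id \<in> Hom nabla 0 n" by (rule interval_embed_Hom) auto
  then obtain \<phi>' y where y: "y \<in> K 0" and cr: "weyl_crossing 0 n (interval_embed 0 id) x \<phi>' y"
    by (rule weyl_sub_pull[OF assms(1)])
  have "snd y = -1" using weyl_crossing_snd[OF cr] assms by simp
  then have "y = weyl_reversal 0"
    using weyl_perm_ends[of y]
    by (intro weyl_eqI[OF weyl_sub_carrier[OF y] weyl_reversal_carrier]) (auto elim!: interval_cases)
  \<comment> \<open>With an empty window starting at 1, every interior point goes to
    \<open>Pinf\<close>; this is just some morphism from degree \<open>m\<close> to degree
    0.\<close>
  then show ?thesis using weyl_sub_crossing[OF weyl_crossing_reversal[OF interval_collapse_Hom[of m 1 0]]] y
    by simp
qed

text \<open>Restricting \<open>x\<close> to two points that it inverts gives the transposition in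
  degree 2. Its pullbacks are the adjacent transpositions, which generate.\<close>

lemma weyl_sub_symmetric:
  assumes x: "x \<in> K n" "x \<in> symmetric_family n" "x \<noteq> \<one>\<^bsub>weyl_group n\<^esub>"
  shows "symmetric_family m \<subseteq> K m"
proof -
  let ?P = "\<lambda>\<sigma>. ((\<sigma>, \<lambda>i\<in>{1..m}. 1), 1) \<in> K m"
  have xc: "x \<in> carrier (weyl_group n)" and sgn: "\<And>i. i \<in> interval n \<Longrightarrow> weyl_sign x i = 1"
    using x(2) by (auto simp: symmetric_family_iff)
  then have snd: "snd x = 1" using sgn[of Minf] by simp
  \<comment> \<open>A permutation of a finite chain without inversions is the identity; as all signs
    are 1, \<open>x\<close> would be the unit.\<close>
  have "\<exists>i\<in>interval n. \<exists>j\<in>interval n. i < j \<and> weyl_perm x j < weyl_perm x i"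
  proof (rule ccontr)
    assume neg: "\<not> ?thesis"
    have "id i = weyl_perm x i" if "i \<in> interval n" for i
    proof (rule order_iso_unique[OF finite_interval _ weyl_perm_bij[OF xc] _ that])
      show "weyl_perm x j < weyl_perm x k" if "j \<in> interval n" "k \<in> interval n" "id j < id k" for j k
        using neg that weyl_perm_inject[OF xc, of j k] by (metis id_apply linorder_neqE order_less_irrefl)
    qed (simp add: bij_betw_def)
    then have "x = \<one>\<^bsub>weyl_group n\<^esub>"
      using sgn by (intro weyl_eqI[OF xc]) auto
    with x show False by blast
  qed
  \<comment> \<open>Both endpoints are fixed because \<theta> = 1, so neither takes part in an
    inversion.\<close>
  then obtain i j where ij: "i \<in> {1..n}" "j \<in> {1..n}" "i < j" "weyl_perm x (Fin j) < weyl_perm x (Fin i)"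
    using weyl_perm_ends(1,2)[OF snd] by (auto elim!: interval_cases)
  let ?\<phi> = "interval_embed 2 (\<lambda>l. if l = 1 then i else j)"
  have "?\<phi> \<in> Hom nabla 2 n" using ij by (intro interval_embed_Hom) auto
  then obtain \<phi>' y where y: "y \<in> K 2" and cr: "weyl_crossing 2 n ?\<phi> x \<phi>' y"
    by (rule weyl_sub_pull[OF x(1)])
  have \<phi>: "?\<phi> (Fin 1) = Fin i" "?\<phi> (Fin 2) = Fin j" by (auto simp: interval_embed_def)
  have "weyl_perm y (Fin 2) < weyl_perm y (Fin 1)"
    using ij by (intro weyl_crossing_less[OF cr]) (auto simp: \<phi>)
  moreover have "weyl_sign y l = 1" if "l \<in> interval 2" for l
    using that weyl_crossingD(6)[OF cr that] sgn Hom_nabla_mem[OF weyl_crossingD(1)[OF cr] that] by simp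
  ultimately have adj: "?P (transpose k (Suc k))" if "k \<in> {1..m}" "Suc k \<in> {1..m}" for k
    using weyl_sub_crossing[OF weyl_crossing_adjacent y] that weyl_sub_carrier[OF y]
      weyl_crossing_snd[OF cr] snd by simp
  have one: "?P id" using weyl_sub_one[of m] by (simp add: weyl_one)
  have mult: "?P (\<sigma> \<circ> \<tau>)" if "?P \<sigma>" "?P \<tau>" for \<sigma> \<tau>
  proof -
    have "\<tau> permutes {1..m}" using weyl_sub_carrier[OF that(2)] by (simp add: weyl_carrier_iff)
    then have "(\<lambda>i\<in>{1..m}. (\<lambda>i\<in>{1..m}. 1) (\<tau> i) * (\<lambda>i\<in>{1..m}. 1) i) = (\<lambda>i\<in>{1..m}. 1::int)"
      using permutes_in_image by (fastforce simp: fun_eq_iff)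
    then show ?thesis using weyl_sub_mult[OF that] by (simp add: weyl_mult)
  qed
  \<comment> \<open>An arbitrary transposition is the product along
    \<open>adj_transp_seq a b\<close>, whose entries lie in \<open>{a..<b}\<close>.\<close>
  have transp: "?P (transpose a b)" if "a \<in> {1..m}" "b \<in> {1..m}" "a < b" for a b
  proof -
    have "?P (apply_adj_transps ks)" if "set ks \<subseteq> {a..<b}" for ks
      using that
    proof (induction ks)
      case (Cons k ks)
      have "?P (transpose k (Suc k))"
        using Cons.prems \<open>a \<in> _\<close> \<open>b \<in> _\<close> by (intro adj) auto
      moreover have "?P (apply_adj_transps ks)"
        by (rule Cons.IH) (use Cons.prems in auto)
      ultimately show ?case using mult by (simp only: apply_adj_transps_Cons Suc_eq_plus1)
    qed (simp add: one)
    from this[of "adj_transp_seq a b"] show ?thesis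
      using adj_transp_seq_correct[OF \<open>a < b\<close>] set_adj_transp_seq[OF \<open>a < b\<close>] by simp
  qed
  have "?P \<sigma>" if "\<sigma> permutes {1..m}" for \<sigma>
    using that finite_atLeastAtMost
  proof (induction rule: permutes_induct)
    case (swap a b p)
    have "?P (transpose a b)"
      using transp[of a b] transp[of b a] swap.hyps
      by (cases a b rule: linorder_cases) (auto simp: transpose_commute)
    with swap.IH mult show ?case by blast
  qed (rule one)
  then show ?thesis by (auto simp: symmetric_family_def sym_group_carrier)
qed

text \<open>Restricted to a point of sign -1, \<open>x\<close> becomes the flip in degree 1. Its
  pullbacks generate all sign vectors, and doubling the point also produces the transposition in
  degree 2, hence all permutations.\<close>

lemma weyl_sub_hyperoctahedral:
  assumes x: "x \<in> K n" "snd x = 1" "i \<in> interval n" "weyl_sign x i = -1"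
  shows "hyperoctahedral_family m \<subseteq> K m"
proof -
  obtain l where l: "l \<in> {1..n}" "i = Fin l"
    using x by (cases rule: interval_cases[OF x(3)]) auto
  have "interval_embed 1 (\<lambda>_. l) \<in> Hom nabla 1 n" using l by (intro interval_embed_Hom) auto
  then obtain \<phi>' y where y: "y \<in> K 1" and cr: "weyl_crossing 1 n (interval_embed 1 (\<lambda>_. l)) x \<phi>' y"
    by (rule weyl_sub_pull[OF x(1)])
  have snd: "snd y = 1" using weyl_crossing_snd[OF cr] x by simp
  have neg: "weyl_sign y (Fin 1) = -1"
    using weyl_crossingD(6)[OF cr, of "Fin 1"] x l by (simp add: interval_embed_def)
  have flip: "((id, \<lambda>i\<in>{1..m}. if i = k then -1 else 1), 1) \<in> K m" for k m
    using weyl_sub_crossing[OF weyl_crossing_flip[OF weyl_sub_carrier[OF y] snd neg] y] .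
  have flips: "((id, \<lambda>i\<in>{1..m}. if i \<in> B then -1 else 1), 1) \<in> K m" if "finite B" for B m
    using that
  proof (induction B)
    case empty
    then show ?case using weyl_sub_one[of m] by (simp only: weyl_one empty_iff if_False)
  next
    case (insert k B)
    \<comment> \<open>As \<open>k\<close> is not in \<open>B\<close>, each index meets at most one
      factor -1.\<close>
    have "((id, \<lambda>i\<in>{1..m}. if i = k then -1 else 1), 1) \<otimes>\<^bsub>weyl_group m\<^esub>
        ((id, \<lambda>i\<in>{1..m}. if i \<in> B then -1 else 1), 1) =
        ((id, \<lambda>i\<in>{1..m}. if i \<in> insert k B then -1 else 1), 1)"
      using insert.hyps by (auto simp: weyl_mult fun_eq_iff)
    then show ?case using weyl_sub_mult[OF flip insert.IH] by metis
  qed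
  have signs: "((id, \<epsilon>), 1) \<in> K m" if "\<epsilon> \<in> {1..m} \<rightarrow>\<^sub>E {-1, 1}" for \<epsilon> m
  proof -
    have "\<epsilon> = (\<lambda>i\<in>{1..m}. if i \<in> {i \<in> {1..m}. \<epsilon> i = -1} then -1 else 1)"
      using that sign_PiE[OF that] by (auto simp: fun_eq_iff PiE_def extensional_def)
    then show ?thesis using flips[of "{i \<in> {1..m}. \<epsilon> i = -1}" m] by simp
  qed
  \<comment> \<open>Doubling the point: both interior points of degree 2 lie in one fibre of sign
    -1, so their order is reversed.\<close>
  have "interval_embed 2 (\<lambda>_. 1) \<in> Hom nabla 2 1" by (intro interval_embed_Hom) auto
  then obtain \<phi>'' z where z: "z \<in> K 2" and cr': "weyl_crossing 2 1 (interval_embed 2 (\<lambda>_. 1)) y \<phi>'' z"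
    by (rule weyl_sub_pull[OF y])
  have z_less: "weyl_perm z (Fin 2) < weyl_perm z (Fin 1)"
    using weyl_crossingD(8)[OF cr', of "Fin 1" "Fin 2"] neg by (simp add: interval_embed_def)
  have snd_z: "snd z = 1" using weyl_crossing_snd[OF cr'] snd by simp
  obtain \<sigma> \<epsilon> where z_eq: "z = ((\<sigma>, \<epsilon>), 1)" using snd_z by (cases z rule: weyl_elt_cases) auto
  have \<epsilon>: "\<epsilon> \<in> {1..2} \<rightarrow>\<^sub>E {-1, 1}" and \<sigma>: "\<sigma> permutes {1..2}"
    using weyl_sub_carrier[OF z] by (auto simp: z_eq weyl_carrier_iff)
  \<comment> \<open>Right multiplication by the sign vector of \<open>z\<close> squares its signs
    away and keeps its permutation.\<close>
  let ?w = "z \<otimes>\<^bsub>weyl_group 2\<^esub> ((id, \<epsilon>), 1)"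
  have "(\<lambda>i\<in>{1..2}. \<epsilon> i * \<epsilon> i) = (\<lambda>i\<in>{1..2}. 1)"
    using sign_PiE[OF \<epsilon>] by (fastforce simp: fun_eq_iff)
  then have w: "?w = ((\<sigma>, \<lambda>i\<in>{1..2}. 1), 1)"
    by (simp add: z_eq weyl_mult)
  have "?w \<noteq> \<one>\<^bsub>weyl_group 2\<^esub>"
    unfolding w using z_less by (auto simp: weyl_one z_eq)
  moreover have "?w \<in> symmetric_family 2"
    using \<sigma> by (auto simp: w symmetric_family_def sym_group_carrier)
  ultimately have sym: "symmetric_family m \<subseteq> K m"
    using weyl_sub_symmetric[OF weyl_sub_mult[OF z signs[OF \<epsilon>]]] by blast
  show ?thesis
  proof
    fix h assume "h \<in> hyperoctahedral_family m"
    then obtain \<tau> \<zeta> where h: "h = ((\<tau>, \<zeta>), 1)" "\<tau> permutes {1..m}" "\<zeta> \<in> {1..m} \<rightarrow>\<^sub>E {-1, 1}"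
      by (auto simp: hyperoctahedral_family_def sym_group_carrier sign_img_def)
    have "((\<tau>, \<lambda>i\<in>{1..m}. 1), 1) \<in> K m"
      using sym h by (auto simp: symmetric_family_def sym_group_carrier)
    from weyl_sub_mult[OF this signs[OF h(3)]] show "h \<in> K m"
      using h(3) by (simp add: weyl_mult h(1) PiE_def extensional_restrict cong: restrict_cong)
  qed
qed

text \<open>Looks for a sign -1 among the elements with \<theta> = 1, then for a nontrivial
  permutation. A single occurrence in one degree forces the whole family in every degree.\<close>

lemma weyl_sub_identity_component:
  obtains F where "F \<in> {trivial_family, symmetric_family, hyperoctahedral_family}"
    "\<And>n. K n \<inter> hyperoctahedral_family n = F n"
proof (cases "\<exists>n x i. x \<in> K n \<and> snd x = 1 \<and> i \<in> interval n \<and> weyl_sign x i = -1")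
  case True
  then have "hyperoctahedral_family m \<subseteq> K m" for m
    using weyl_sub_hyperoctahedral by blast
  then show thesis by (intro that[of hyperoctahedral_family]) auto
next
  case False
  then have sub: "K n \<inter> hyperoctahedral_family n \<subseteq> symmetric_family n" for n
    using weyl_sign_cases weyl_sub_carrier by (fastforce simp: symmetric_family_iff hyperoctahedral_family_iff)
  show thesis
  proof (cases "\<exists>n x. x \<in> K n \<and> x \<in> symmetric_family n \<and> x \<noteq> \<one>\<^bsub>weyl_group n\<^esub>")
    case True
    then have "symmetric_family m \<subseteq> K m" for m
      using weyl_sub_symmetric by blast
    then show thesis
      using sub by (intro that[of symmetric_family]) (auto simp: symmetric_family_eq)
  next
    case False
    have "K n \<inter> hyperoctahedral_family n = trivial_family n" for n
    proof
      show "K n \<inter> hyperoctahedral_family n \<subseteq> trivial_family n"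
        using False sub[of n] unfolding trivial_family_iff[THEN eq_reflection] subset_iff by blast
      show "trivial_family n \<subseteq> K n \<inter> hyperoctahedral_family n"
        using weyl_sub_one by (auto simp: trivial_family_iff hyperoctahedral_family_iff)
    qed
    then show thesis by (intro that[of trivial_family]) auto
  qed
qed

text \<open>Multiplying by the reversal moves an element with \<theta> = -1 to \<theta> = 1, where
  \<open>sub\<close> applies; multiplying by the same involution again returns to it.\<close>

lemma weyl_sub_subset:
  assumes L: "crossed_subgroup nabla weyl L" and "weyl_reversal n \<in> K n" "weyl_reversal n \<in> L n"
    and sub: "K n \<inter> hyperoctahedral_family n \<subseteq> L n"
  shows "K n \<subseteq> L n"
proof
  interpret group "weyl_group n" by (rule group_weyl_group)
  interpret L: subgroup "L n" "weyl_group n" using L unfolding crossed_subgroup_weyl_iff by blast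
  fix x assume x: "x \<in> K n"
  show "x \<in> L n"
  proof (cases "snd x = 1")
    case True
    then have "x \<in> hyperoctahedral_family n" using weyl_sub_carrier[OF x] by (simp add: hyperoctahedral_family_iff)
    then show ?thesis using sub x by blast
  next
    case False
    then have "snd x = -1" using snd_weyl_cases[OF weyl_sub_carrier[OF x]] by blast
    then have "x \<otimes>\<^bsub>weyl_group n\<^esub> weyl_reversal n \<in> hyperoctahedral_family n"
      using weyl_sub_carrier[OF weyl_sub_mult[OF x assms(2)]] by (simp add: hyperoctahedral_family_iff)
    then have "x \<otimes>\<^bsub>weyl_group n\<^esub> weyl_reversal n \<in> L n"
      using weyl_sub_mult[OF x assms(2)] sub by blast
    from L.m_closed[OF this assms(3)] show ?thesis
      using weyl_sub_carrier[OF x] by (simp add: m_assoc weyl_reversal_mult)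
  qed
qed

end

section \<open>Assembling the classification\<close>

lemma crossed_subgroup_weyl_eqI:
  assumes "crossed_subgroup nabla weyl K" "crossed_subgroup nabla weyl L"
    and "\<And>n. weyl_reversal n \<in> K n" "\<And>n. weyl_reversal n \<in> L n"
    and "\<And>n. K n \<inter> hyperoctahedral_family n = L n \<inter> hyperoctahedral_family n"
  shows "K = L"
  using weyl_sub_subset[OF assms(1,2)] weyl_sub_subset[OF assms(2,1)] assms(3-5) by blast

text \<open>Two invariants decide: whether \<theta> = -1 occurs, and which of three families the
  part with \<theta> = 1 is. Each of the six combinations is realised by one listed family.\<close>

lemma crossed_subgroup_weyl_classification:
  assumes K: "crossed_subgroup nabla weyl K"
  shows "K \<in> {trivial_family, reflexive_family, symmetric_family,
       reflexosymmetric_family, hyperoctahedral_family, weyl_family}"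
proof -
  obtain F where F: "F \<in> {trivial_family, symmetric_family, hyperoctahedral_family}"
    and KF: "\<And>n. K n \<inter> hyperoctahedral_family n = F n"
    by (rule weyl_sub_identity_component[OF K]) blast
  show ?thesis
  proof (cases "\<exists>n. \<exists>x\<in>K n. snd x = -1")
    case True
    then have rev: "weyl_reversal n \<in> K n" for n using weyl_sub_reversal[OF K] by blast
    have "K = L" if "crossed_subgroup nabla weyl L" "\<And>n. weyl_reversal n \<in> L n"
      "\<And>n. L n \<inter> hyperoctahedral_family n = F n" for L
      using crossed_subgroup_weyl_eqI[OF K that(1) rev that(2)] KF that(3) by simp
    note eq = this
    consider "F = trivial_family" | "F = symmetric_family" | "F = hyperoctahedral_family"
      using F by blast
    then show ?thesis
    proof cases
      case 1
      have "K = reflexive_family"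
        by (rule eq[OF crossed_subgroup_reflexive]) (simp_all add: 1 reflexive_family_iff trivial_family_eq)
      then show ?thesis by simp
    next
      case 2
      have "K = reflexosymmetric_family"
        by (rule eq[OF crossed_subgroup_reflexosymmetric])
          (simp_all add: 2 reflexosymmetric_family_iff weyl_reversal_sign symmetric_family_eq del: weyl_sign.simps)
      then show ?thesis by simp
    next
      case 3
      have "K = weyl_family"
        by (rule eq[OF crossed_subgroup_weyl_family])
          (auto simp: 3 weyl_family_def hyperoctahedral_family_iff)
      then show ?thesis by simp
    qed
  next
    case False
    then have "K n \<subseteq> hyperoctahedral_family n" for n
      using weyl_sub_carrier[OF K] snd_weyl_cases by (fastforce simp: hyperoctahedral_family_iff)
    then have "K = F" using KF by (auto simp: fun_eq_iff)
    then show ?thesis using F by blast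
  qed
qed

text \<open>Three test elements separate the families: the reversal in degree 0, the flip in degree
  1 and the transposition in degree 2.\<close>

lemma six_families_distinct:
  "distinct [trivial_family, reflexive_family, symmetric_family,
    reflexosymmetric_family, hyperoctahedral_family, weyl_family]" (is "distinct ?Fs")
proof -
  let ?rev = "weyl_reversal 0"
  let ?flip = "((id, \<lambda>i\<in>{1..1}. -1), 1) :: weyl_elt"
  let ?swap = "((transpose 1 2, \<lambda>i\<in>{1..2}. 1), 1) :: weyl_elt"
  let ?key = "\<lambda>K. (?rev \<in> K 0, ?flip \<in> K 1, ?swap \<in> K 2)"
  have "?flip \<in> carrier (weyl_group 1)" "?swap \<in> carrier (weyl_group 2)"
    using permutes_swap_id[of 1 "{1..2}" "2::nat"] by (auto simp: weyl_carrier_iff permutes_id)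
  note carrier = this weyl_reversal_carrier[of 0]
  have flip_sign: "\<exists>i\<in>interval 1. weyl_sign ?flip i \<noteq> 1"
    by (rule bexI[of _ "Fin 1"]) auto
  have "(transpose 1 2 :: nat \<Rightarrow> nat) 1 \<noteq> id 1" by simp
  then have swap: "(transpose 1 2 :: nat \<Rightarrow> nat) \<noteq> id" by metis
  have swap_sign: "weyl_sign ?swap i = 1" if "i \<in> interval 2" for i
    using that by (auto elim!: interval_cases)
  have flip: "(\<lambda>i\<in>{1..1::nat}. -1) \<noteq> (\<lambda>i\<in>{1..1}. 1 :: int)"
    by (auto simp: fun_eq_iff)
  have "?key trivial_family = (False, False, False)"
    using swap flip by (simp add: trivial_family_iff weyl_one)
  moreover have "?key reflexive_family = (True, False, False)"
    using swap flip by (simp add: reflexive_family_iff weyl_one)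
  moreover have rs: "?key reflexosymmetric_family = (True, False, True)"
    using carrier swap_sign flip_sign weyl_reversal_sign[of _ 0]
    by (auto simp: reflexosymmetric_family_iff simp del: weyl_sign.simps)
  moreover have "?key symmetric_family = (False, False, True)"
    using carrier rs by (simp add: symmetric_family_eq hyperoctahedral_family_iff)
  moreover have "?key hyperoctahedral_family = (False, True, True)"
    using carrier by (simp add: hyperoctahedral_family_iff)
  moreover have "?key weyl_family = (True, True, True)"
    using carrier by (simp add: weyl_family_def)
  \<comment> \<open>The six keys are pairwise different, so the families are as well.\<close>
  ultimately have "distinct (map ?key ?Fs)" by simp
  then show ?thesis by (simp only: distinct_map)
qed

section \<open>Isomorphism types in each degree\<close>

lemma reflexive_family_iso: "(weyl_group n)\<lparr>carrier := reflexive_family n\<rparr> \<cong> sign_img"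
proof (rule is_isoI)
  show "snd \<in> iso ((weyl_group n)\<lparr>carrier := reflexive_family n\<rparr>) sign_img"
    by (auto simp: iso_def hom_def bij_betw_def inj_on_def image_def reflexive_family_def sign_img_def
        weyl_one weyl_mult)
qed

lemma symmetric_family_iso: "(weyl_group n)\<lparr>carrier := symmetric_family n\<rparr> \<cong> sym_group n"
proof (rule is_isoI)
  show "fst \<circ> fst \<in> iso ((weyl_group n)\<lparr>carrier := symmetric_family n\<rparr>) (sym_group n)"
    by (auto simp: iso_def hom_def bij_betw_def inj_on_def image_def symmetric_family_def
        sym_group_mult weyl_mult)
qed

text \<open>The common sign reappears as \<theta>, so dropping the sign vector loses no
  information.\<close>

lemma reflexosymmetric_family_iso:
  "(weyl_group n)\<lparr>carrier := reflexosymmetric_family n\<rparr> \<cong> sym_group n \<times>\<times> sign_img"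
proof (rule is_isoI)
  show "(\<lambda>x. (fst (fst x), snd x)) \<in>
      iso ((weyl_group n)\<lparr>carrier := reflexosymmetric_family n\<rparr>) (sym_group n \<times>\<times> sign_img)"
    by (auto simp: iso_def hom_def bij_betw_def inj_on_def image_def reflexosymmetric_family_def
        sym_group_mult sign_img_def weyl_mult)
qed

lemma hyperoctahedral_family_iso:
  "(weyl_group n)\<lparr>carrier := hyperoctahedral_family n\<rparr> \<cong> hyperoctahedral_group n"
proof (rule is_isoI)
  show "fst \<in> iso ((weyl_group n)\<lparr>carrier := hyperoctahedral_family n\<rparr>) (hyperoctahedral_group n)"
    by (auto simp: iso_def hom_def bij_betw_def inj_on_def image_def hyperoctahedral_family_def
        hyperoctahedral_group_def weyl_mult)
qed

lemma weyl_family_iso: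
  "(weyl_group n)\<lparr>carrier := weyl_family n\<rparr> \<cong> hyperoctahedral_group n \<times>\<times> sign_img"
proof -
  have "(weyl_group n)\<lparr>carrier := weyl_family n\<rparr> = weyl_group n"
    by (simp add: weyl_family_def)
  then show ?thesis by (simp add: weyl_group_def iso_refl)
qed

theorem mainTheorem9:
  shows "{K. crossed_subgroup nabla weyl K} =
      {trivial_family, reflexive_family, symmetric_family,
       reflexosymmetric_family, hyperoctahedral_family, weyl_family}
    \<and> card {K. crossed_subgroup nabla weyl K} = 6
    \<and> (\<forall>n.
        (weyl_group n)\<lparr>carrier := reflexive_family n\<rparr> \<cong> sign_img
      \<and> (weyl_group n)\<lparr>carrier := symmetric_family n\<rparr> \<cong> sym_group n
      \<and> (weyl_group n)\<lparr>carrier := reflexosymmetric_family n\<rparr> \<cong> sym_group n \<times>\<times> sign_img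
      \<and> (weyl_group n)\<lparr>carrier := hyperoctahedral_family n\<rparr> \<cong> hyperoctahedral_group n
      \<and> (weyl_group n)\<lparr>carrier := weyl_family n\<rparr> \<cong> hyperoctahedral_group n \<times>\<times> sign_img)"
proof -
  have eq: "{K. crossed_subgroup nabla weyl K} =
      {trivial_family, reflexive_family, symmetric_family,
       reflexosymmetric_family, hyperoctahedral_family, weyl_family}" (is "_ = ?S")
    using crossed_subgroup_weyl_classification crossed_subgroup_trivial crossed_subgroup_reflexive
      crossed_subgroup_symmetric crossed_subgroup_reflexosymmetric crossed_subgroup_hyperoctahedral
      crossed_subgroup_weyl_family
    by blast
  have "card ?S = 6"
    using distinct_card[OF six_families_distinct] by simp
  with eq show ?thesis
    by (simp only: reflexive_family_iso symmetric_family_iso reflexosymmetric_family_iso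
        hyperoctahedral_family_iso weyl_family_iso simp_thms)
qed

end
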